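(* Assume $M=O(1)$, i.e. the integer $M\ge 2$ is bounded by a constant independent of $n$. There is a constant $d>0$ (independent of $n$ and of the probabilities $p_m$) such that if $p_2,\ldots,p_M\in[0,1]$ (which may depend on $n$) satisfy $$\sum_{m=2}^M p_m\binom{2n}{m}\ \ge\ d\,n\ln n,$$ then with probability $1-o(1)$ as $n\to\infty$, the algorithm COLOR (described in the context), applied to the random non-uniform bipartite hypergraph $H_{n,(p_m)_{m=2,\ldots,M}}$, finds a proper 2-coloring of this hypergraph.
   Context: Random model. The hypergraph $H=H_{n,(p_m)_{m=2,\ldots,M}}=(V,E)$ has vertex set $V=\{1,2,\ldots,2n\}$, which is arbitrarily split into two disjoint sets $U_1,U_2$ of size $n$ each (the planted color classes). A set $e\subset V$ is monochromatic if $e\subset U_1$ or $e\subset U_2$. Each $e\subset V$ is included in $E$ independently; if $e$ is not monochromatic and $|e|=m$ with $2\le m\le M$ it is included with probability $p_m$, and otherwise it is included with probability $0$. A proper 2-coloring of $H=(V,E)$ is a partition of $V$ into two sets such that no edge $e\in E$ is contained in one of the two sets. Algorithm COLOR, with input a hypergraph $H=(V,E)$ on $2n$ vertices (it does not know $U_1,U_2$): 1. Define the symmetric matrix $A\in\mathbb{R}^{V\times V}$ by $A_{ij}=\sum_{e\in E:\, i,j\in e}\frac1{|e|}$ for $i\ne j$ and $A_{ii}=\sum_{e\in E:\, i\in e}\frac1{|e|}$. 2. Compute $x^A=\arg\min_{\|x\|_2=1}x^TAx$ (a unit eigenvector for the smallest eigenvalue of $A$). 3. Let $T=\lceil\log_2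 n\rceil$, $V_1^{(0)}=\{i\in V: x^A_i\ge 0\}$, $V_2^{(0)}=\{i\in V: x^A_i<0\}$. 4. For $t=1,2,\ldots,T$ let $$V_1^{(t)}=\Big\{i\in V:\ \sum_{j\in V_1^{(t-1)}\setminus\{i\}}A_{ij}<\sum_{j\in V_2^{(t-1)}\setminus\{i\}}A_{ij}\Big\},\qquad V_2^{(t)}=V\setminus V_1^{(t)}.$$ 5. If there is $e\in E$ with $e\subset V_1^{(T)}$ or $e\subset V_2^{(T)}$, the algorithm fails; otherwise it outputs the 2-coloring of $V$ given by the partition $V_1^{(T)},V_2^{(T)}$. *)

theory Defs
  imports "HOL-Probability.Probability"
begin

text \<open>Hypergraphs on a vertex set \<open>V\<close> are given by their edge set \<open>E\<close>. Throughout, the random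
  hypergraph and the algorithm live on \<open>V = {1..2 * n}\<close>.\<close>

definition planted_split :: "nat \<Rightarrow> nat set \<Rightarrow> nat set \<Rightarrow> bool" where
  "planted_split n U1 U2 \<longleftrightarrow>
     U1 \<union> U2 = {1..2 * n} \<and> U1 \<inter> U2 = {} \<and> card U1 = n \<and> card U2 = n"

definition monochromatic :: "nat set \<Rightarrow> nat set \<Rightarrow> nat set \<Rightarrow> bool" where
  "monochromatic U1 U2 e \<longleftrightarrow> e \<subseteq> U1 \<or> e \<subseteq> U2"

definition edge_prob :: "nat set \<Rightarrow> nat set \<Rightarrow> nat \<Rightarrow> (nat \<Rightarrow> real) \<Rightarrow> nat set \<Rightarrow> real" where
  "edge_prob U1 U2 M p e =
     (if \<not> monochromatic U1 U2 e \<and> 2 \<le> card e \<and> card e \<le> M then p (card e) else 0)"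

definition random_hypergraph ::
  "nat \<Rightarrow> nat set \<Rightarrow> nat set \<Rightarrow> nat \<Rightarrow> (nat \<Rightarrow> real) \<Rightarrow> nat set set pmf" where
  "random_hypergraph n U1 U2 M p =
     map_pmf (\<lambda>f. {e \<in> Pow {1..2 * n}. f e})
       (Pi_pmf (Pow {1..2 * n}) False (\<lambda>e. bernoulli_pmf (edge_prob U1 U2 M p e)))"

definition proper_2_coloring :: "'a set \<Rightarrow> 'a set set \<Rightarrow> 'a set \<Rightarrow> 'a set \<Rightarrow> bool" where
  "proper_2_coloring V E W1 W2 \<longleftrightarrow>
     W1 \<union> W2 = V \<and> W1 \<inter> W2 = {} \<and> (\<forall>e\<in>E. \<not> e \<subseteq> W1 \<and> \<not> e \<subseteq> W2)"

text \<open>For \<open>i = j\<close> the sum below runs over all edges containing \<open>i\<close>, so this single formula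
  gives the off-diagonal and the diagonal entries.\<close>

definition hyper_matrix :: "'a set set \<Rightarrow> 'a \<Rightarrow> 'a \<Rightarrow> real" where
  "hyper_matrix E i j = (\<Sum>e | e \<in> E \<and> i \<in> e \<and> j \<in> e. 1 / real (card e))"

definition quad_form :: "'a set \<Rightarrow> ('a \<Rightarrow> 'a \<Rightarrow> real) \<Rightarrow> ('a \<Rightarrow> real) \<Rightarrow> real" where
  "quad_form V A x = (\<Sum>i\<in>V. \<Sum>j\<in>V. x i * A i j * x j)"

text \<open>Vectors indexed by \<open>V\<close> are functions of which only the values on \<open>V\<close> matter.
  The minimizer is never unique (\<open>- x\<close> is another one), hence a predicate.\<close>

definition min_unit_vector :: "'a set \<Rightarrow> ('a \<Rightarrow> 'a \<Rightarrow> real) \<Rightarrow> ('a \<Rightarrow> real) \<Rightarrow> bool" where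
  "min_unit_vector V A x \<longleftrightarrow> is_arg_min (quad_form V A) (\<lambda>y. L2_set y V = 1) x"

text \<open>Only the first class is tracked; the second one is its complement in \<open>V\<close> at every
  stage, including the initial one.\<close>

definition color_init :: "'a set \<Rightarrow> ('a \<Rightarrow> real) \<Rightarrow> 'a set" where
  "color_init V x = {i \<in> V. x i \<ge> 0}"

definition color_step :: "'a set \<Rightarrow> ('a \<Rightarrow> 'a \<Rightarrow> real) \<Rightarrow> 'a set \<Rightarrow> 'a set" where
  "color_step V A W = {i \<in> V. (\<Sum>j\<in>W - {i}. A i j) < (\<Sum>j\<in>(V - W) - {i}. A i j)}"

text \<open>A run of the algorithm in which the vector computed in the spectral step is \<open>x\<close>;
  \<open>None\<close> means failure.\<close>

definition COLOR :: "nat \<Rightarrow> nat set set \<Rightarrow> (nat \<Rightarrow> real) \<Rightarrow> (nat set \<times> nat set) option" where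
  "COLOR n E x =
     (let V = {1..2 * n};
          T = nat \<lceil>log 2 (real n)\<rceil>;
          W = (color_step V (hyper_matrix E) ^^ T) (color_init V x)
      in if \<exists>e\<in>E. e \<subseteq> W \<or> e \<subseteq> V - W then None else Some (W, V - W))"

text \<open>Success is required whichever minimizer the spectral step returns.\<close>

definition COLOR_succeeds :: "nat \<Rightarrow> nat set set \<Rightarrow> bool" where
  "COLOR_succeeds n E \<longleftrightarrow>
     (\<forall>x. min_unit_vector {1..2 * n} (hyper_matrix E) x \<longrightarrow>
        (\<exists>W1 W2. COLOR n E x = Some (W1, W2) \<and> proper_2_coloring {1..2 * n} E W1 W2))"

end

theory Submission
  imports Defs "HOL-Library.Multiset"
begin

text \<open>
  Why the theorem holds. Let \<open>A\<close> be the matrix of the algorithm, \<open>B\<close> its expectation, and \<open>D\<close> (up to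
  a constant factor) the expected degree of a vertex; the hypothesis says \<open>D \<ge> d ln n\<close>.

  By symmetry \<open>B\<close> has only three different entries: one on the diagonal, \<open>a\<close> for two vertices of
  the same class and \<open>b\<close> for two vertices of different classes. Forbidding monochromatic edges makes
  \<open>b\<close> larger than \<open>a\<close>, and because edge sizes are bounded by \<open>K\<close>, even \<open>n (b - a) \<ge> \<delta> D\<close> with
  \<open>\<delta> = (2K)\<^sup>-\<^sup>K\<close> (\<open>cross_binomial_lower_bound\<close>, \<open>mean_gap\<close>). So the sign vector \<open>y\<close> of the planted
  classes spans the bottom eigenspace of \<open>B\<close>, with a spectral gap of at least \<open>\<delta> D\<close>.

  The heart of the matter is that \<open>\<parallel>A - B\<parallel> \<le> \<epsilon> D\<close> with high probability for any fixed \<open>\<epsilon>\<close>, once \<open>d\<close>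
  is large (\<open>prob_not_fluct_bounded\<close>). This is the trace method: the expected trace of
  \<open>(A - B)\<^sup>2\<^sup>k\<close> is a sum over walks of length \<open>2k\<close> that alternate between vertices and edges
  containing them. Only walks using each of their edges at least twice contribute, hence walks with
  at most \<open>k\<close> distinct edges. Instead of classifying these walks, each distinct edge is charged an
  extra factor \<open>1 / \<theta>\<close> at the price of a global factor \<open>\<theta>\<^sup>k\<close>; after that all walks may be counted, and a
  short induction on the length gives the bound \<open>2n (8kD)\<^sup>k\<close> (\<open>weighted_walk_bound\<close>,
  \<open>expectation_trace_power\<close>). For \<open>k\<close> between \<open>ln n\<close> and \<open>2 ln n\<close> Markov's inequality concludes. Taking
  \<open>k\<close> a power of two lets repeated use of the Cauchy-Schwarz inequality replace the spectral theorem
  when passing from the trace to the norm (\<open>operator_norm_le_trace_power\<close>).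

  A Chernoff bound (\<open>chernoff\<close>, \<open>prob_not_margin_ok\<close>) shows moreover that with high probability every
  vertex sees a clear majority, by at least \<open>\<delta> D / 2\<close>, of the opposite planted class.

  The rest is deterministic (locale \<open>near_planted\<close>). The gap and the norm bound force the minimizer to
  be strongly correlated with \<open>y\<close>, so its signs misplace at most \<open>\<delta> n / 8\<close> vertices, up to exchanging
  the classes (\<open>few_wrong_initially\<close>). A vertex misplaced after a round must have lost its
  majority through the vertices misplaced before that round; by the norm bound this can happen to at
  most a quarter as many vertices (\<open>color_step_quarters_wrong\<close>). After \<open>\<lceil>log\<^sub>2 n\<rceil>\<close> rounds none is left, and
  the planted classes are a proper coloring.
\<close>

section \<open>Independent Bernoulli variables\<close>

lemma exp_le_quadratic:
  fixes u :: real
  assumes "\<bar>u\<bar> \<le> 1"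
  shows "exp u \<le> 1 + u + u\<^sup>2"
proof (cases "0 \<le> u")
  case True
  thus ?thesis using exp_bound[of u] assms by simp
next
  case False
  have "1 - u \<le> exp (- u)" using exp_ge_add_one_self[of "- u"] by simp
  hence "exp u \<le> 1 / (1 - u)"
    using False by (simp add: exp_minus field_simps)
  also have "\<dots> \<le> 1 + u + u\<^sup>2"
  proof -
    have "u ^ 3 \<le> 0" using False by (simp add: power3_eq_cube mult_nonneg_nonpos)
    hence "1 \<le> (1 + u + u\<^sup>2) * (1 - u)" by (simp add: algebra_simps power2_eq_square power3_eq_cube)
    thus ?thesis using False by (simp add: field_simps)
  qed
  finally show ?thesis .
qed

locale bernoulli_family =
  fixes I :: "'e set" and q :: "'e \<Rightarrow> real"
  assumes finite_I: "finite I"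
    and q_nonneg: "\<And>e. e \<in> I \<Longrightarrow> 0 \<le> q e"
    and q_le_1: "\<And>e. e \<in> I \<Longrightarrow> q e \<le> 1"
begin

abbreviation P :: "('e \<Rightarrow> bool) pmf" where
  "P \<equiv> Pi_pmf I False (\<lambda>e. bernoulli_pmf (q e))"

definition \<eta> :: "('e \<Rightarrow> bool) \<Rightarrow> 'e \<Rightarrow> real" where
  "\<eta> f e = of_bool (f e) - q e"

lemma integrable_P [simp, intro]:
  fixes g :: "('e \<Rightarrow> bool) \<Rightarrow> real"
  shows "integrable (measure_pmf P) g"
proof (rule integrable_measure_pmf_finite)
  have "set_pmf P \<subseteq> PiE_dflt I False (\<lambda>_. UNIV)"
    using set_Pi_pmf_subset'[OF finite_I, of False "\<lambda>e. bernoulli_pmf (q e)"]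
    by (auto simp: PiE_dflt_def)
  moreover have "finite (PiE_dflt I False (\<lambda>_. UNIV :: bool set))"
    using finite_I by (intro finite_PiE_dflt) auto
  ultimately show "finite (set_pmf P)" by (rule finite_subset)
qed

lemma expectation_prod:
  fixes g :: "'e \<Rightarrow> bool \<Rightarrow> real"
  shows "measure_pmf.expectation P (\<lambda>f. \<Prod>e\<in>I. g e (f e))
           = (\<Prod>e\<in>I. q e * g e True + (1 - q e) * g e False)"
proof (cases "I = {}")
  case False
  have ind: "prob_space.indep_vars (measure_pmf P) (\<lambda>_. borel) (\<lambda>e f. g e (f e)) I"
  proof -
    have "prob_space.indep_vars (measure_pmf P) (\<lambda>_. count_space UNIV) (\<lambda>e f. f e) I"
      by (rule indep_vars_Pi_pmf[OF finite_I])
    from prob_space.indep_vars_compose2[OF prob_space_measure_pmf this, of g "\<lambda>_. borel"]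
    show ?thesis by simp
  qed
  have "measure_pmf.expectation P (\<lambda>f. \<Prod>e\<in>I. g e (f e))
          = (\<Prod>e\<in>I. measure_pmf.expectation P (\<lambda>f. g e (f e)))"
    by (rule prob_space.indep_vars_lebesgue_integral[OF prob_space_measure_pmf finite_I ind]) auto
  also have "\<dots> = (\<Prod>e\<in>I. q e * g e True + (1 - q e) * g e False)"
  proof (rule prod.cong[OF refl])
    fix e assume e: "e \<in> I"
    have "measure_pmf.expectation P (\<lambda>f. g e (f e))
            = measure_pmf.expectation (map_pmf (\<lambda>f. f e) P) (g e)"
      by simp
    also have "map_pmf (\<lambda>f. f e) P = bernoulli_pmf (q e)"
      by (subst Pi_pmf_component[OF finite_I]) (simp add: e)
    also have "measure_pmf.expectation (bernoulli_pmf (q e)) (g e)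
                 = q e * g e True + (1 - q e) * g e False"
      using q_nonneg[OF e] q_le_1[OF e] by simp
    finally show "measure_pmf.expectation P (\<lambda>f. g e (f e))
                    = q e * g e True + (1 - q e) * g e False" .
  qed
  finally show ?thesis .
qed simp

text \<open>
  The expectation factorizes over distinct indices, and a factor of multiplicity one vanishes. Hence
  either the product has mean zero or at most \<open>k\<close> distinct indices occur. In the second case each
  of them contributes at most \<open>q e\<close>, and \<open>\<theta> ^ k\<close> makes up for the divisions by \<open>\<theta>\<close>. The point of
  the weights \<open>q e / \<theta>\<close> is that the right-hand side mentions no restriction on multiplicities any more,
  so that it can be summed over all products.
\<close>

lemma mixed_moment_bound:
  assumes es: "set_mset es \<subseteq> I" and size: "size es = 2 * k" and \<theta>: "1 \<le> \<theta>"
  shows "\<bar>measure_pmf.expectation P (\<lambda>f. \<Prod>e\<in>#es. \<eta> f e)\<bar>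
           \<le> \<theta> ^ k * (\<Prod>e\<in>set_mset es. q e / \<theta>)"
proof -
  define \<mu> where "\<mu> e c = q e * (1 - q e) ^ c + (1 - q e) * (- q e) ^ c" for e and c :: nat
  have prod_nonneg: "0 \<le> (\<Prod>e\<in>set_mset es. q e / \<theta>)"
    using es q_nonneg \<theta> by (intro prod_nonneg) auto
  have prod_eq: "(\<Prod>e\<in>#es. \<eta> f e) = (\<Prod>e\<in>I. (of_bool (f e) - q e) ^ count es e)" for f
  proof -
    have "(\<Prod>e\<in>#es. \<eta> f e) = (\<Prod>e\<in>set_mset es. \<eta> f e ^ count es e)"
      by (rule image_prod_mset_multiplicity)
    also have "\<dots> = (\<Prod>e\<in>I. \<eta> f e ^ count es e)"
      using es finite_I by (intro prod.mono_neutral_left) (auto simp: not_in_iff)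
    finally show ?thesis by (simp add: \<eta>_def)
  qed
  have "measure_pmf.expectation P (\<lambda>f. \<Prod>e\<in>#es. \<eta> f e) = (\<Prod>e\<in>I. \<mu> e (count es e))"
    unfolding prod_eq
    using expectation_prod[of "\<lambda>e b. (of_bool b - q e) ^ count es e"] by (simp add: \<mu>_def)
  also have "\<dots> = (\<Prod>e\<in>set_mset es. \<mu> e (count es e))"
    using es finite_I by (intro prod.mono_neutral_right) (auto simp: not_in_iff \<mu>_def)
  finally have E: "measure_pmf.expectation P (\<lambda>f. \<Prod>e\<in>#es. \<eta> f e)
                     = (\<Prod>e\<in>set_mset es. \<mu> e (count es e))" .
  show ?thesis
  proof (cases "\<exists>e\<in>set_mset es. count es e = 1")
    case True
    then obtain e where e: "e \<in> set_mset es" "count es e = 1" by blast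
    have "\<mu> e (count es e) = 0" by (simp add: \<mu>_def e(2) algebra_simps)
    hence "(\<Prod>e\<in>set_mset es. \<mu> e (count es e)) = 0" using e(1) by auto
    thus ?thesis unfolding E using prod_nonneg \<theta> by (simp only:) simp
  next
    case False
    have count: "2 \<le> count es e" if "e \<in> set_mset es" for e
      using False that by (metis One_nat_def Suc_1 Suc_leI count_greater_zero_iff le_neq_implies_less)
    have "2 * card (set_mset es) = (\<Sum>e\<in>set_mset es. 2)" by simp
    also have "\<dots> \<le> (\<Sum>e\<in>set_mset es. count es e)" by (intro sum_mono count)
    also have "\<dots> = 2 * k" using size by (simp add: size_multiset_overloaded_eq)
    finally have card: "card (set_mset es) \<le> k" by simp
    have "\<bar>\<Prod>e\<in>set_mset es. \<mu> e (count es e)\<bar> = (\<Prod>e\<in>set_mset es. \<bar>\<mu> e (count es e)\<bar>)"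
      by (rule abs_prod)
    also have "\<dots> \<le> (\<Prod>e\<in>set_mset es. q e)"
    proof (rule prod_mono)
      fix e assume e: "e \<in> set_mset es"
      have q: "0 \<le> q e" "q e \<le> 1" using e es q_nonneg q_le_1 by auto
      have "\<bar>\<mu> e (count es e)\<bar> \<le> q e * (1 - q e) ^ count es e + (1 - q e) * q e ^ count es e"
        unfolding \<mu>_def using q by (intro order.trans[OF abs_triangle_ineq]) (simp add: abs_mult power_abs)
      also have "\<dots> \<le> q e * (1 - q e) ^ 2 + (1 - q e) * q e ^ 2"
        using q count[OF e] by (intro add_mono mult_left_mono power_decreasing) auto
      also have "\<dots> = q e * (1 - q e)" by (simp add: power2_eq_square algebra_simps)
      also have "\<dots> \<le> q e" using q by (simp add: mult_left_le)
      finally show "0 \<le> \<bar>\<mu> e (count es e)\<bar> \<and> \<bar>\<mu> e (count es e)\<bar> \<le> q e" by simp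
    qed
    also have "\<dots> = \<theta> ^ card (set_mset es) * (\<Prod>e\<in>set_mset es. q e / \<theta>)"
      using \<theta> by (simp add: prod_dividef)
    also have "\<dots> \<le> \<theta> ^ k * (\<Prod>e\<in>set_mset es. q e / \<theta>)"
      using \<theta> card prod_nonneg by (intro mult_right_mono power_increasing) auto
    finally show ?thesis unfolding E .
  qed
qed

text \<open>
  Only the indices of nonzero weight enter the variance proxy \<open>D\<close>, which is what makes the bound
  useful for the edges at a single vertex.
\<close>

lemma chernoff:
  assumes s: "0 \<le> s" "s \<le> 1"
    and w: "\<And>e. e \<in> I \<Longrightarrow> \<bar>w e\<bar> \<le> 1"
    and D: "(\<Sum>e | e \<in> I \<and> w e \<noteq> 0. q e) \<le> D"
  shows "measure_pmf.prob P {f. (\<Sum>e\<in>I. of_bool (f e) * w e) \<ge> (\<Sum>e\<in>I. q e * w e) + t}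
           \<le> exp (s\<^sup>2 * D - s * t)"
proof -
  define m where "m = (\<Sum>e\<in>I. q e * w e)"
  define Y where "Y f = exp (s * (\<Sum>e\<in>I. of_bool (f e) * w e))" for f :: "'e \<Rightarrow> bool"
  have Y: "Y f = (\<Prod>e\<in>I. exp (s * (of_bool (f e) * w e)))" for f
    unfolding Y_def sum_distrib_left by (rule exp_sum[OF finite_I])
  have "measure_pmf.expectation P Y = (\<Prod>e\<in>I. q e * exp (s * w e) + (1 - q e))"
    unfolding Y using expectation_prod[of "\<lambda>e b. exp (s * (of_bool b * w e))"] by simp
  also have "\<dots> \<le> (\<Prod>e\<in>I. exp (q e * (s * w e + s\<^sup>2 * of_bool (w e \<noteq> 0))))"
  proof (rule prod_mono, intro conjI)
    fix e assume e: "e \<in> I"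
    show "0 \<le> q e * exp (s * w e) + (1 - q e)"
      using q_nonneg[OF e] q_le_1[OF e] by (intro add_nonneg_nonneg) auto
    have sw: "\<bar>s * w e\<bar> \<le> 1" using s w[OF e] by (simp add: abs_mult mult_le_one)
    have w2: "(w e)\<^sup>2 \<le> of_bool (w e \<noteq> 0)"
      using w[OF e] by (auto simp: abs_square_le_1)
    have "exp (s * w e) \<le> 1 + s * w e + (s * w e)\<^sup>2" by (rule exp_le_quadratic[OF sw])
    also have "\<dots> \<le> 1 + s * w e + s\<^sup>2 * of_bool (w e \<noteq> 0)"
      using mult_left_mono[OF w2, of "s\<^sup>2"] by (simp add: power_mult_distrib)
    finally have "q e * exp (s * w e) + (1 - q e)
        \<le> q e * (1 + s * w e + s\<^sup>2 * of_bool (w e \<noteq> 0)) + (1 - q e)"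
      using q_nonneg[OF e] by (simp only: add_right_mono mult_left_mono)
    also have "\<dots> = 1 + q e * (s * w e + s\<^sup>2 * of_bool (w e \<noteq> 0))" by (simp add: algebra_simps)
    also have "\<dots> \<le> exp (q e * (s * w e + s\<^sup>2 * of_bool (w e \<noteq> 0)))" by (rule exp_ge_add_one_self)
    finally show "q e * exp (s * w e) + (1 - q e)
      \<le> exp (q e * (s * w e + s\<^sup>2 * of_bool (w e \<noteq> 0)))" .
  qed
  also have "\<dots> = exp (s * m + s\<^sup>2 * (\<Sum>e | e \<in> I \<and> w e \<noteq> 0. q e))"
  proof -
    have "(\<Sum>e\<in>I. q e * (s * w e + s\<^sup>2 * of_bool (w e \<noteq> 0)))
            = s * m + s\<^sup>2 * (\<Sum>e\<in>I. q e * of_bool (w e \<noteq> 0))"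
      by (simp add: m_def sum_distrib_left algebra_simps flip: sum.distrib)
    also have "(\<Sum>e\<in>I. q e * of_bool (w e \<noteq> 0)) = (\<Sum>e | e \<in> I \<and> w e \<noteq> 0. q e)"
      using finite_I by (simp add: of_bool_def if_distrib sum.If_cases Int_def cong: if_cong)
    finally show ?thesis by (simp add: finite_I flip: exp_sum)
  qed
  also have "\<dots> \<le> exp (s * m + s\<^sup>2 * D)"
    using D by (simp add: mult_left_mono)
  finally have EY: "measure_pmf.expectation P Y \<le> exp (s * m + s\<^sup>2 * D)" .
  have "measure_pmf.prob P {f. (\<Sum>e\<in>I. of_bool (f e) * w e) \<ge> m + t}
          \<le> measure_pmf.prob P {f \<in> space (measure_pmf P). Y f \<ge> exp (s * (m + t))}"
    by (rule measure_pmf.finite_measure_mono) (auto simp: Y_def s mult_left_mono)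
  also have "\<dots> \<le> measure_pmf.expectation P Y / exp (s * (m + t))"
    by (rule integral_Markov_inequality_measure[where A = "{}"]) (auto simp: Y_def)
  also have "\<dots> \<le> exp (s * m + s\<^sup>2 * D) / exp (s * (m + t))"
    using EY by (simp add: divide_right_mono)
  also have "\<dots> = exp (s\<^sup>2 * D - s * t)"
    by (simp add: algebra_simps flip: exp_diff)
  finally show ?thesis by (simp add: m_def)
qed

end

section \<open>Operator norms and traces of powers\<close>

definition dotp :: "'a set \<Rightarrow> ('a \<Rightarrow> real) \<Rightarrow> ('a \<Rightarrow> real) \<Rightarrow> real" where
  "dotp V x z = (\<Sum>i\<in>V. x i * z i)"

definition mat_vec :: "'a set \<Rightarrow> ('a \<Rightarrow> 'a \<Rightarrow> real) \<Rightarrow> ('a \<Rightarrow> real) \<Rightarrow> 'a \<Rightarrow> real" where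
  "mat_vec V A x i = (\<Sum>j\<in>V. A i j * x j)"

lemma dotp_self_nonneg: "0 \<le> dotp V x x"
  by (simp add: dotp_def sum_nonneg)

lemma dotp_cauchy_schwarz: "(dotp V x z)\<^sup>2 \<le> dotp V x x * dotp V z z"
  using Cauchy_Schwarz_ineq_sum[of x z V] by (simp add: dotp_def power2_eq_square)

lemma abs_dotp_le:
  assumes "dotp V x x \<le> a\<^sup>2" "dotp V z z \<le> b\<^sup>2" "0 \<le> a" "0 \<le> b"
  shows "\<bar>dotp V x z\<bar> \<le> a * b"
proof (rule power2_le_imp_le)
  have "(dotp V x z)\<^sup>2 \<le> dotp V x x * dotp V z z" by (rule dotp_cauchy_schwarz)
  also have "\<dots> \<le> a\<^sup>2 * b\<^sup>2" using assms dotp_self_nonneg by (intro mult_mono) auto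
  finally show "\<bar>dotp V x z\<bar>\<^sup>2 \<le> (a * b)\<^sup>2" by (simp add: power_mult_distrib)
qed (use assms in simp)

lemma quad_form_eq_dotp: "quad_form V A x = dotp V x (mat_vec V A x)"
  by (simp add: quad_form_def dotp_def mat_vec_def sum_distrib_left mult.assoc)

lemma dotp_mat_vec_symmetric:
  assumes "\<And>i j. i \<in> V \<Longrightarrow> j \<in> V \<Longrightarrow> X i j = X j i"
  shows "dotp V (mat_vec V X x) z = dotp V x (mat_vec V X z)"
proof -
  have "dotp V (mat_vec V X x) z = (\<Sum>i\<in>V. \<Sum>j\<in>V. X i j * x j * z i)"
    by (simp add: dotp_def mat_vec_def sum_distrib_right)
  also have "\<dots> = (\<Sum>j\<in>V. \<Sum>i\<in>V. X i j * x j * z i)" by (rule sum.swap)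
  also have "\<dots> = (\<Sum>j\<in>V. \<Sum>i\<in>V. x j * (X j i * z i))"
    by (intro sum.cong refl) (simp add: assms)
  finally show ?thesis by (simp add: dotp_def mat_vec_def sum_distrib_left)
qed

lemma dotp_mat_vec_power_symmetric:
  assumes "\<And>i j. i \<in> V \<Longrightarrow> j \<in> V \<Longrightarrow> X i j = X j i"
  shows "dotp V ((mat_vec V X ^^ r) x) z = dotp V x ((mat_vec V X ^^ r) z)"
proof (induction r arbitrary: z)
  case (Suc r)
  have "dotp V ((mat_vec V X ^^ Suc r) x) z = dotp V ((mat_vec V X ^^ r) x) (mat_vec V X z)"
    by (simp add: dotp_mat_vec_symmetric[OF assms])
  also have "\<dots> = dotp V x ((mat_vec V X ^^ Suc r) z)"
    by (simp add: Suc funpow_swap1)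
  finally show ?case .
qed simp

text \<open>
  Moving half of the powers of a symmetric \<open>X\<close> to the other side of the inner product turns
  \<open>\<parallel>X\<^sup>r x\<parallel>\<^sup>2\<close> into the inner product of \<open>x\<close> and \<open>X\<^sup>2\<^sup>r x\<close>.
\<close>

lemma norm_mat_vec_power_log_convex:
  fixes x :: "'a \<Rightarrow> real"
  assumes "\<And>i j. i \<in> V \<Longrightarrow> j \<in> V \<Longrightarrow> X i j = X j i"
  defines "a \<equiv> \<lambda>r. dotp V ((mat_vec V X ^^ r) x) ((mat_vec V X ^^ r) x)"
  shows "(a r)\<^sup>2 \<le> dotp V x x * a (2 * r)"
proof -
  have "a r = dotp V x ((mat_vec V X ^^ (2 * r)) x)"
    unfolding a_def by (subst dotp_mat_vec_power_symmetric[OF assms(1)])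
      (simp_all add: mult_2 funpow_add)
  thus ?thesis using dotp_cauchy_schwarz[of V x "(mat_vec V X ^^ (2 * r)) x"] by (simp add: a_def)
qed

lemma norm_mat_vec_power_pow2:
  fixes x :: "'a \<Rightarrow> real"
  assumes sym: "\<And>i j. i \<in> V \<Longrightarrow> j \<in> V \<Longrightarrow> X i j = X j i"
  defines "a \<equiv> \<lambda>r. dotp V ((mat_vec V X ^^ r) x) ((mat_vec V X ^^ r) x)"
  shows "a 1 ^ (2 ^ j) \<le> dotp V x x ^ (2 ^ j - 1) * a (2 ^ j)"
proof (induction j)
  case (Suc j)
  have nn: "0 \<le> a r" for r by (simp add: a_def dotp_self_nonneg)
  have "a 1 ^ (2 ^ Suc j) = (a 1 ^ (2 ^ j))\<^sup>2" by (simp add: power_mult mult.commute flip: power_mult)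
  also have "\<dots> \<le> (dotp V x x ^ (2 ^ j - 1) * a (2 ^ j))\<^sup>2"
    using Suc nn by (intro power_mono) auto
  also have "\<dots> = (dotp V x x ^ (2 ^ j - 1))\<^sup>2 * (a (2 ^ j))\<^sup>2" by (rule power_mult_distrib)
  also have "\<dots> \<le> (dotp V x x ^ (2 ^ j - 1))\<^sup>2 * (dotp V x x * a (2 * 2 ^ j))"
    unfolding a_def by (intro mult_left_mono norm_mat_vec_power_log_convex sym) auto
  also have "\<dots> = dotp V x x ^ Suc (2 * (2 ^ j - 1)) * a (2 ^ Suc j)"
    by (simp add: power_mult[symmetric] mult.commute)
  also have "Suc (2 * (2 ^ j - 1)) = 2 ^ Suc j - (1::nat)"
    using one_le_power[of "2::nat" j] unfolding power_Suc by linarith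
  finally show ?case .
qed simp

definition unit_vec :: "'a \<Rightarrow> 'a \<Rightarrow> real" where
  "unit_vec j i = of_bool (i = j)"

lemma mat_vec_power_expand:
  assumes "finite V" "i \<in> V"
  shows "(mat_vec V X ^^ r) x i = (\<Sum>j\<in>V. x j * (mat_vec V X ^^ r) (unit_vec j) i)"
  using assms(2)
proof (induction r arbitrary: i)
  case 0
  have "(\<Sum>j\<in>V. x j * unit_vec j i) = (\<Sum>j\<in>V. if j = i then x j else 0)"
    by (intro sum.cong) (auto simp: unit_vec_def)
  thus ?case using assms(1) 0 by simp
next
  case (Suc r)
  have "(mat_vec V X ^^ Suc r) x i
          = (\<Sum>l\<in>V. X i l * (\<Sum>j\<in>V. x j * (mat_vec V X ^^ r) (unit_vec j) l))"
    by (simp add: mat_vec_def[of V X _ i] Suc.IH)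
  also have "\<dots> = (\<Sum>l\<in>V. \<Sum>j\<in>V. x j * (X i l * (mat_vec V X ^^ r) (unit_vec j) l))"
    by (simp add: sum_distrib_left mult_ac)
  also have "\<dots> = (\<Sum>j\<in>V. \<Sum>l\<in>V. x j * (X i l * (mat_vec V X ^^ r) (unit_vec j) l))"
    by (rule sum.swap)
  finally show ?case by (simp add: mat_vec_def[of V X _ i] sum_distrib_left)
qed

definition trace_power :: "'a set \<Rightarrow> ('a \<Rightarrow> 'a \<Rightarrow> real) \<Rightarrow> nat \<Rightarrow> real" where
  "trace_power V X r = (\<Sum>j\<in>V. (mat_vec V X ^^ r) (unit_vec j) j)"

lemma trace_power_even:
  assumes fin: "finite V" and sym: "\<And>i j. i \<in> V \<Longrightarrow> j \<in> V \<Longrightarrow> X i j = X j i"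
  shows "trace_power V X (2 * r)
           = (\<Sum>j\<in>V. dotp V ((mat_vec V X ^^ r) (unit_vec j)) ((mat_vec V X ^^ r) (unit_vec j)))"
  unfolding trace_power_def
proof (rule sum.cong[OF refl])
  fix j assume j: "j \<in> V"
  have "dotp V ((mat_vec V X ^^ r) (unit_vec j)) ((mat_vec V X ^^ r) (unit_vec j))
          = dotp V (unit_vec j) ((mat_vec V X ^^ (2 * r)) (unit_vec j))"
    by (subst dotp_mat_vec_power_symmetric[OF sym]) (simp_all add: mult_2 funpow_add)
  also have "\<dots> = (\<Sum>i\<in>V. if i = j then (mat_vec V X ^^ (2 * r)) (unit_vec j) i else 0)"
    unfolding dotp_def by (intro sum.cong) (auto simp: unit_vec_def)
  also have "\<dots> = (mat_vec V X ^^ (2 * r)) (unit_vec j) j" using fin j by simp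
  finally show "(mat_vec V X ^^ (2 * r)) (unit_vec j) j
    = dotp V ((mat_vec V X ^^ r) (unit_vec j)) ((mat_vec V X ^^ r) (unit_vec j))" by simp
qed

lemma norm_mat_vec_power_le_trace:
  assumes fin: "finite V" and sym: "\<And>i j. i \<in> V \<Longrightarrow> j \<in> V \<Longrightarrow> X i j = X j i"
  shows "dotp V ((mat_vec V X ^^ r) x) ((mat_vec V X ^^ r) x) \<le> dotp V x x * trace_power V X (2 * r)"
proof -
  let ?c = "\<lambda>j i. (mat_vec V X ^^ r) (unit_vec j) i"
  have "dotp V ((mat_vec V X ^^ r) x) ((mat_vec V X ^^ r) x) = (\<Sum>i\<in>V. (\<Sum>j\<in>V. x j * ?c j i)\<^sup>2)"
    unfolding dotp_def
    by (intro sum.cong refl) (simp only: mat_vec_power_expand[OF fin, where x = x] power2_eq_square)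
  also have "\<dots> \<le> (\<Sum>i\<in>V. (\<Sum>j\<in>V. (x j)\<^sup>2) * (\<Sum>j\<in>V. (?c j i)\<^sup>2))"
    by (intro sum_mono Cauchy_Schwarz_ineq_sum)
  also have "\<dots> = dotp V x x * (\<Sum>i\<in>V. \<Sum>j\<in>V. (?c j i)\<^sup>2)"
    by (simp add: dotp_def power2_eq_square sum_distrib_left)
  also have "(\<Sum>i\<in>V. \<Sum>j\<in>V. (?c j i)\<^sup>2) = trace_power V X (2 * r)"
    by (subst sum.swap) (simp add: trace_power_even[OF fin sym] dotp_def power2_eq_square)
  finally show ?thesis .
qed

text \<open>
  The trace of an even power of a symmetric matrix is the squared Frobenius norm of half that power,
  and so dominates the squared operator norm of that power. Doubling the exponent repeatedly by
  log-convexity carries this back to the first power without any appeal to eigenvalues; this is why \<open>k\<close>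
  is a power of two.
\<close>

lemma operator_norm_le_trace_power:
  assumes fin: "finite V" and sym: "\<And>i j. i \<in> V \<Longrightarrow> j \<in> V \<Longrightarrow> X i j = X j i"
    and k: "k = 2 ^ l" and "0 \<le> b" and tr: "trace_power V X (2 * k) \<le> b ^ (2 * k)"
  shows "dotp V (mat_vec V X x) (mat_vec V X x) \<le> b\<^sup>2 * dotp V x x"
proof -
  have k0: "0 < k" by (simp add: k)
  have "dotp V (mat_vec V X x) (mat_vec V X x) ^ k
          \<le> dotp V x x ^ (k - 1) * dotp V ((mat_vec V X ^^ k) x) ((mat_vec V X ^^ k) x)"
    using norm_mat_vec_power_pow2[OF sym, where x = x and j = l and V = V] by (simp add: k)
  also have "\<dots> \<le> dotp V x x ^ (k - 1) * (dotp V x x * trace_power V X (2 * k))"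
    by (intro mult_left_mono norm_mat_vec_power_le_trace fin sym zero_le_power dotp_self_nonneg)
  also have "\<dots> = dotp V x x ^ k * trace_power V X (2 * k)"
    using k0 by (cases k) auto
  also have "\<dots> \<le> dotp V x x ^ k * b ^ (2 * k)"
    by (intro mult_left_mono tr zero_le_power dotp_self_nonneg)
  also have "\<dots> = (b\<^sup>2 * dotp V x x) ^ k"
    unfolding power_mult power_mult_distrib by (rule mult.commute)
  finally have "dotp V (mat_vec V X x) (mat_vec V X x) ^ Suc (k - 1) \<le> (b\<^sup>2 * dotp V x x) ^ Suc (k - 1)"
    using k0 by simp
  thus ?thesis
    by (rule power_le_imp_le_base) (simp add: dotp_self_nonneg)
qed

section \<open>Norm of the centred random matrix\<close>

locale random_hypermatrix = bernoulli_family I q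
  for I :: "'a set set" and q :: "'a set \<Rightarrow> real" +
  fixes V :: "'a set" and D :: real
  assumes finite_V: "finite V"
    and edges_subset: "\<And>e. e \<in> I \<Longrightarrow> e \<subseteq> V"
    and D_nonneg: "0 \<le> D"
    and degree_le: "\<And>i. i \<in> V \<Longrightarrow> (\<Sum>e | e \<in> I \<and> i \<in> e. q e) \<le> D"
begin

text \<open>
  The deviation of \<open>hyper_matrix\<close> of the random edge set from its expectation.
\<close>

definition fluct :: "('a set \<Rightarrow> bool) \<Rightarrow> 'a \<Rightarrow> 'a \<Rightarrow> real" where
  "fluct f i j = (\<Sum>e | e \<in> I \<and> i \<in> e \<and> j \<in> e. \<eta> f e / real (card e))"

lemma fluct_symmetric: "fluct f i j = fluct f j i"
  by (simp add: fluct_def conj_commute conj_left_commute)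

text \<open>
  Applying the matrix is one step of a walk: choose an edge at \<open>i\<close>, then a uniformly random vertex
  of that edge. The weights \<open>1 / card e\<close> are exactly the probabilities of the second choice, so edge
  sizes do not enter the bounds below.
\<close>

lemma mat_vec_fluct:
  "mat_vec V (fluct f) x i
     = (\<Sum>e | e \<in> I \<and> i \<in> e. 1 / real (card e) * (\<Sum>u\<in>e. \<eta> f e * x u))"
proof -
  have "mat_vec V (fluct f) x i
          = (\<Sum>u\<in>V. \<Sum>e | (e \<in> I \<and> i \<in> e) \<and> u \<in> e. 1 / real (card e) * (\<eta> f e * x u))"
    by (simp add: mat_vec_def fluct_def sum_distrib_right conj_assoc)
  also have "\<dots> = (\<Sum>u\<in>V. \<Sum>e\<in>{e. e \<in> I \<and> i \<in> e}.
                   if u \<in> e then 1 / real (card e) * (\<eta> f e * x u) else 0)"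
    using finite_I by (intro sum.cong refl sum.mono_neutral_cong_left) auto
  also have "\<dots> = (\<Sum>e\<in>{e. e \<in> I \<and> i \<in> e}. \<Sum>u\<in>V.
                   if u \<in> e then 1 / real (card e) * (\<eta> f e * x u) else 0)"
    by (rule sum.swap)
  also have "\<dots> = (\<Sum>e | e \<in> I \<and> i \<in> e. \<Sum>u\<in>e. 1 / real (card e) * (\<eta> f e * x u))"
    using finite_V edges_subset by (intro sum.cong refl sum.mono_neutral_cong_right) auto
  finally show ?thesis by (simp add: sum_distrib_left)
qed

text \<open>
  Think of \<open>es\<close> as the edges already used by a walk that is now at \<open>i\<close> and has \<open>r\<close> steps to go. The next
  edge is either one of the old ones, of weight 1 and at most \<open>card (set_mset es)\<close> in number, or a new
  one at \<open>i\<close>, and these have total weight at most \<open>D / \<theta>\<close>. Since the number of old edges grows by at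
  most one while \<open>r\<close> drops by one, the base of the power on the right does not increase along the walk.
\<close>

lemma weighted_walk_bound:
  assumes \<theta>: "1 \<le> \<theta>" and z: "\<And>i. i \<in> V \<Longrightarrow> \<bar>z i\<bar> \<le> 1"
    and es: "set_mset es \<subseteq> I" and size: "size es + r = 2 * k" and i: "i \<in> V"
  shows "\<bar>measure_pmf.expectation P (\<lambda>f. (\<Prod>e\<in>#es. \<eta> f e) * (mat_vec V (fluct f) ^^ r) z i)\<bar>
           \<le> \<theta> ^ k * (\<Prod>e\<in>set_mset es. q e / \<theta>) * (real (card (set_mset es)) + r + D / \<theta>) ^ r"
  using es size i
proof (induction r arbitrary: es i)
  case 0
  have "\<bar>measure_pmf.expectation P (\<lambda>f. (\<Prod>e\<in>#es. \<eta> f e) * z i)\<bar>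
          = \<bar>measure_pmf.expectation P (\<lambda>f. \<Prod>e\<in>#es. \<eta> f e)\<bar> * \<bar>z i\<bar>"
    by (simp add: abs_mult)
  also have "\<dots> \<le> (\<theta> ^ k * (\<Prod>e\<in>set_mset es. q e / \<theta>)) * 1"
    using 0 by (intro mult_mono' mixed_moment_bound \<theta> z) auto
  finally show ?case by simp
next
  case (Suc r)
  define C where "C = \<theta> ^ k * (\<Prod>e\<in>set_mset es. q e / \<theta>)"
  define B where "B = real (card (set_mset es)) + Suc r + D / \<theta>"
  define w where "w e = (if e \<in> set_mset es then 1 else q e / \<theta>)" for e
  let ?Y = "\<lambda>f. (mat_vec V (fluct f) ^^ r) z"
  let ?N = "{e. e \<in> I \<and> i \<in> e}"
  have fin: "finite ?N" using finite_I by simp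
  have D\<theta>: "0 \<le> D / \<theta>" using \<theta> D_nonneg by simp
  have C0: "0 \<le> C" unfolding C_def using Suc.prems(1) q_nonneg \<theta>
    by (intro mult_nonneg_nonneg prod_nonneg) auto
  have w0: "0 \<le> w e" if "e \<in> I" for e using q_nonneg[OF that] \<theta> by (simp add: w_def)
  have "(\<Sum>e\<in>?N. w e) \<le> (\<Sum>e\<in>?N. of_bool (e \<in> set_mset es) + q e / \<theta>)"
    using q_nonneg \<theta> by (intro sum_mono) (auto simp: w_def)
  also have "\<dots> = real (card (?N \<inter> set_mset es)) + (\<Sum>e\<in>?N. q e) / \<theta>"
    using fin by (simp add: sum.distrib sum_divide_distrib)
  also have "\<dots> \<le> real (card (set_mset es)) + D / \<theta>"
    using degree_le[OF Suc.prems(3)] \<theta>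
    by (intro add_mono divide_right_mono) (auto intro!: card_mono)
  also have "\<dots> \<le> B" by (simp add: B_def)
  finally have weights: "(\<Sum>e\<in>?N. w e) \<le> B" .
  have "measure_pmf.expectation P (\<lambda>f. (\<Prod>e\<in>#es. \<eta> f e) * (mat_vec V (fluct f) ^^ Suc r) z i)
          = measure_pmf.expectation P (\<lambda>f. \<Sum>e\<in>?N. 1 / real (card e) *
              (\<Sum>u\<in>e. (\<Prod>e\<in>#add_mset e es. \<eta> f e) * ?Y f u))"
    by (simp add: mat_vec_fluct sum_distrib_left mult_ac)
  also have "\<dots> = (\<Sum>e\<in>?N. 1 / real (card e) *
              (\<Sum>u\<in>e. measure_pmf.expectation P (\<lambda>f. (\<Prod>e\<in>#add_mset e es. \<eta> f e) * ?Y f u)))"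
    by (simp del: image_mset_add_mset prod_mset.add_mset)
  also have "\<bar>\<dots>\<bar> \<le> (\<Sum>e\<in>?N. 1 / real (card e) * (\<Sum>u\<in>e. C * w e * B ^ r))"
  proof (intro order.trans[OF sum_abs] sum_mono)
    fix e assume e: "e \<in> ?N"
    have "\<bar>\<Sum>u\<in>e. measure_pmf.expectation P (\<lambda>f. (\<Prod>e\<in>#add_mset e es. \<eta> f e) * ?Y f u)\<bar>
            \<le> (\<Sum>u\<in>e. C * w e * B ^ r)"
    proof (intro order.trans[OF sum_abs] sum_mono)
      fix u assume u: "u \<in> e"
      have "\<bar>measure_pmf.expectation P (\<lambda>f. (\<Prod>e\<in>#add_mset e es. \<eta> f e) * ?Y f u)\<bar>
         \<le> \<theta> ^ k * (\<Prod>e\<in>set_mset (add_mset e es). q e / \<theta>)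
             * (real (card (set_mset (add_mset e es))) + r + D / \<theta>) ^ r"
        using e u edges_subset Suc.prems by (intro Suc.IH) auto
      also have "\<theta> ^ k * (\<Prod>e\<in>set_mset (add_mset e es). q e / \<theta>) = C * w e"
        by (auto simp: C_def w_def insert_absorb)
      also have "C * w e * (real (card (set_mset (add_mset e es))) + r + D / \<theta>) ^ r \<le> C * w e * B ^ r"
      proof (intro mult_left_mono power_mono)
        show "real (card (set_mset (add_mset e es))) + r + D / \<theta> \<le> B"
          by (simp add: B_def card_insert_if)
      qed (use C0 w0 e D\<theta> in auto)
      finally show "\<bar>measure_pmf.expectation P (\<lambda>f. (\<Prod>e\<in>#add_mset e es. \<eta> f e) * ?Y f u)\<bar>
        \<le> C * w e * B ^ r" .
    qed
    thus "\<bar>1 / real (card e) * (\<Sum>u\<in>e. measure_pmf.expectation P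
              (\<lambda>f. (\<Prod>e\<in>#add_mset e es. \<eta> f e) * ?Y f u))\<bar>
          \<le> 1 / real (card e) * (\<Sum>u\<in>e. C * w e * B ^ r)"
      by (simp only: abs_mult) (intro mult_mono, auto)
  qed
  also have "\<dots> = (\<Sum>e\<in>?N. C * w e * B ^ r)"
  proof (intro sum.cong refl)
    fix e assume e: "e \<in> ?N"
    hence "card e \<noteq> 0" using finite_subset[OF edges_subset finite_V, of e] by auto
    thus "1 / real (card e) * (\<Sum>u\<in>e. C * w e * B ^ r) = C * w e * B ^ r" by simp
  qed
  also have "\<dots> = C * B ^ r * (\<Sum>e\<in>?N. w e)" by (simp add: sum_distrib_left mult_ac)
  also have "\<dots> \<le> C * B ^ r * B"
    using C0 D\<theta> by (intro mult_left_mono weights) (auto simp: B_def)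
  also have "\<dots> = C * B ^ Suc r" by simp
  finally show ?case by (simp only: C_def B_def)
qed

text \<open>
  The choice \<open>\<theta> = D / (2 * k)\<close> balances the two kinds of steps: then \<open>2 * k\<close> bounds both the number of
  old edges and the total weight of the new ones.
\<close>

lemma expectation_trace_power:
  assumes k: "0 < k" and D: "2 * real k \<le> D"
  shows "measure_pmf.expectation P (\<lambda>f. trace_power V (fluct f) (2 * k))
           \<le> real (card V) * (8 * k * D) ^ k"
proof -
  define \<theta> where "\<theta> = D / (2 * k)"
  have \<theta>: "1 \<le> \<theta>" using k D by (simp add: \<theta>_def)
  have D\<theta>: "D / \<theta> = 2 * k" using k D by (simp add: \<theta>_def)
  have "measure_pmf.expectation P (\<lambda>f. trace_power V (fluct f) (2 * k))
          = (\<Sum>j\<in>V. measure_pmf.expectation P (\<lambda>f. (mat_vec V (fluct f) ^^ (2 * k)) (unit_vec j) j))"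
    unfolding trace_power_def by simp
  also have "\<dots> \<le> (\<Sum>j\<in>V. (8 * k * D) ^ k)"
  proof (rule sum_mono)
    fix j assume j: "j \<in> V"
    have "\<bar>measure_pmf.expectation P (\<lambda>f. (\<Prod>e\<in>#{#}. \<eta> f e) * (mat_vec V (fluct f) ^^ (2 * k)) (unit_vec j) j)\<bar>
       \<le> \<theta> ^ k * (\<Prod>e\<in>set_mset {#}. q e / \<theta>) * (real (card (set_mset {#} :: 'a set set)) + real (2 * k) + D / \<theta>) ^ (2 * k)"
      using j by (intro weighted_walk_bound \<theta>) (auto simp: unit_vec_def)
    also have "\<dots> = \<theta> ^ k * ((4 * real k)\<^sup>2) ^ k"
      unfolding D\<theta> power_mult[of _ 2 k] by simp
    also have "\<dots> = (\<theta> * (4 * real k)\<^sup>2) ^ k" by (rule power_mult_distrib[symmetric])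
    also have "\<theta> * (4 * real k)\<^sup>2 = 8 * k * D"
      using k by (simp add: \<theta>_def power2_eq_square)
    finally show "measure_pmf.expectation P (\<lambda>f. (mat_vec V (fluct f) ^^ (2 * k)) (unit_vec j) j)
      \<le> (8 * k * D) ^ k" by simp
  qed
  finally show ?thesis by simp
qed

definition fluct_bounded :: "real \<Rightarrow> ('a set \<Rightarrow> bool) \<Rightarrow> bool" where
  "fluct_bounded b f \<longleftrightarrow>
     (\<forall>x. dotp V (mat_vec V (fluct f) x) (mat_vec V (fluct f) x) \<le> b\<^sup>2 * dotp V x x)"

text \<open>
  Markov's inequality gives \<open>(8kD / (\<epsilon>D)\<^sup>2)\<^sup>k\<close> per vertex; the hypothesis on \<open>D\<close> makes the base at most
  \<open>1/9 < exp (- 2)\<close>, so that \<open>k \<ge> ln n\<close> gives a failure probability of order \<open>1 / n\<close>.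
\<close>

lemma prob_not_fluct_bounded:
  assumes k: "k = 2 ^ l" and \<epsilon>: "0 < \<epsilon>" "\<epsilon> \<le> 1" and D: "72 * real k \<le> \<epsilon>\<^sup>2 * D"
  shows "measure_pmf.prob P {f. \<not> fluct_bounded (\<epsilon> * D) f} \<le> real (card V) * (1 / 9) ^ k"
proof -
  have k0: "0 < k" by (simp add: k)
  have "\<epsilon>\<^sup>2 * D \<le> 1 * D" using \<epsilon> D_nonneg by (intro mult_right_mono) (auto simp: power_le_one)
  hence D2: "2 * real k \<le> D" using D by linarith
  have D0: "0 < D" using D2 k0 by linarith
  have c0: "0 < (\<epsilon> * D) ^ (2 * k)" using \<epsilon> D0 by simp
  have "measure_pmf.prob P {f. \<not> fluct_bounded (\<epsilon> * D) f}
     \<le> measure_pmf.prob P {f \<in> space (measure_pmf P). trace_power V (fluct f) (2 * k) \<ge> (\<epsilon> * D) ^ (2 * k)}"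
  proof (rule measure_pmf.finite_measure_mono, rule subsetI)
    fix f assume "f \<in> {f. \<not> fluct_bounded (\<epsilon> * D) f}"
    hence nb: "\<not> fluct_bounded (\<epsilon> * D) f" by simp
    have "trace_power V (fluct f) (2 * k) \<ge> (\<epsilon> * D) ^ (2 * k)"
    proof (rule ccontr)
      assume "\<not> ?thesis"
      hence "trace_power V (fluct f) (2 * k) \<le> (\<epsilon> * D) ^ (2 * k)" by simp
      hence "fluct_bounded (\<epsilon> * D) f"
        unfolding fluct_bounded_def using \<epsilon> D0
        by (intro allI operator_norm_le_trace_power[OF finite_V _ k]) (auto intro: fluct_symmetric)
      thus False using nb by simp
    qed
    thus "f \<in> {f \<in> space (measure_pmf P). trace_power V (fluct f) (2 * k) \<ge> (\<epsilon> * D) ^ (2 * k)}"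
      by simp
  qed simp
  also have "\<dots> \<le> measure_pmf.expectation P (\<lambda>f. trace_power V (fluct f) (2 * k)) / (\<epsilon> * D) ^ (2 * k)"
  proof (rule integral_Markov_inequality_measure[where A = "{}"])
    show "AE f in measure_pmf P. 0 \<le> trace_power V (fluct f) (2 * k)"
    proof (rule AE_I2)
      fix f
      have "trace_power V (fluct f) (2 * k) = (\<Sum>j\<in>V. dotp V ((mat_vec V (fluct f) ^^ k) (unit_vec j))
               ((mat_vec V (fluct f) ^^ k) (unit_vec j)))"
        by (intro trace_power_even finite_V fluct_symmetric)
      thus "0 \<le> trace_power V (fluct f) (2 * k)" by (simp add: sum_nonneg dotp_self_nonneg)
    qed
  qed (use c0 in auto)
  also have "\<dots> \<le> real (card V) * (8 * k * D) ^ k / (\<epsilon> * D) ^ (2 * k)"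
    using expectation_trace_power[OF k0 D2] c0 by (intro divide_right_mono) auto
  also have "\<dots> = real (card V) * ((8 * k * D) / (\<epsilon> * D)\<^sup>2) ^ k"
    by (simp add: power_mult power_divide)
  also have "\<dots> \<le> real (card V) * (1 / 9) ^ k"
  proof (intro mult_left_mono power_mono)
    have "9 * (8 * k * D) \<le> (\<epsilon> * D)\<^sup>2"
      using mult_right_mono[OF D, of D] D0 by (simp add: power2_eq_square mult_ac)
    thus "8 * k * D / (\<epsilon> * D)\<^sup>2 \<le> 1 / 9" using \<epsilon> D0 by (simp add: field_simps)
  qed (use D0 in auto)
  finally show ?thesis .
qed

end

section \<open>Algorithm COLOR on a perturbed block matrix\<close>

definition signs :: "'a set \<Rightarrow> 'a \<Rightarrow> real" where
  "signs W i = (if i \<in> W then 1 else -1)"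

lemma signs_mult_self [simp]: "signs W i * signs W i = 1"
  by (simp add: signs_def)

lemma sum_signs_balanced:
  assumes "finite V" "V = U1 \<union> U2" "U1 \<inter> U2 = {}" "card U1 = n" "card U2 = n"
  shows "(\<Sum>i\<in>V. signs U1 i) = 0"
proof -
  have "(\<Sum>i\<in>V. signs U1 i) = (\<Sum>i\<in>U1. signs U1 i) + (\<Sum>i\<in>U2. signs U1 i)"
    using assms by (simp add: sum.union_disjoint)
  also have "(\<Sum>i\<in>U1. signs U1 i) = n" using assms by (simp add: signs_def)
  also have "(\<Sum>i\<in>U2. signs U1 i) = (\<Sum>i\<in>U2. - 1)"
    using assms by (intro sum.cong) (auto simp: signs_def)
  finally show ?thesis using assms by simp
qed

text \<open>
  The deterministic input to the algorithm. \<open>A\<close> is close in operator norm to a block matrix \<open>B\<close> whose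
  entries are larger across the two classes than inside them, and in \<open>A\<close> itself every vertex is joined
  to the opposite class more strongly than to its own. The value of \<open>\<epsilon>\<close> is dictated by two needs: the initial
  partition must be close enough for the rounds to start (\<open>\<epsilon>\<close> of order \<open>\<delta>\<^sup>2\<close>), and a round must
  contract (\<open>\<epsilon>\<close> of order \<open>\<delta>\<close>).
\<close>

locale near_planted =
  fixes V U1 U2 :: "'a set" and n :: nat
    and A B :: "'a \<Rightarrow> 'a \<Rightarrow> real" and a b c D \<delta> \<epsilon> :: real
  assumes finite_V: "finite V"
    and V_eq: "V = U1 \<union> U2" and disjoint: "U1 \<inter> U2 = {}"
    and card_U: "card U1 = n" "card U2 = n" and n_pos: "0 < n"
    and B_block: "\<And>i j. i \<in> V \<Longrightarrow> j \<in> V \<Longrightarrow>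
        B i j = (if i = j then c else if (i \<in> U1) = (j \<in> U1) then a else b)"
    and a_nonneg: "0 \<le> a" and b_le: "n * b \<le> D" and D_pos: "0 < D"
    and \<delta>_pos: "0 < \<delta>" and \<delta>_le: "\<delta> \<le> 1" and \<epsilon>_def: "\<epsilon> = \<delta>\<^sup>2 / 32"
    and gap: "\<delta> * D \<le> n * (b - a)"
    and close: "\<And>x. dotp V (mat_vec V (\<lambda>i j. A i j - B i j) x) (mat_vec V (\<lambda>i j. A i j - B i j) x)
                   \<le> (\<epsilon> * D)\<^sup>2 * dotp V x x"
    and margin: "\<And>i. i \<in> V \<Longrightarrow>
        signs U1 i * (\<Sum>j\<in>V - {i}. A i j * signs U1 j) \<le> - (\<delta> / 2 * D)"
begin

abbreviation y :: "'a \<Rightarrow> real" where "y \<equiv> signs U1"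

abbreviation E :: "'a \<Rightarrow> 'a \<Rightarrow> real" where "E \<equiv> (\<lambda>i j. A i j - B i j)"

lemma \<epsilon>_pos: "0 < \<epsilon>"
  using \<delta>_pos by (simp add: \<epsilon>_def)

lemma a_le_b: "a \<le> b"
proof -
  have "0 < real n * (b - a)" using gap D_pos \<delta>_pos by (smt (verit) mult_pos_pos)
  thus ?thesis using n_pos by (simp add: zero_less_mult_iff)
qed

lemma card_V: "card V = 2 * n"
  using finite_V disjoint card_U by (simp add: V_eq card_Un_disjoint)

lemma sum_y: "(\<Sum>i\<in>V. y i) = 0"
  by (rule sum_signs_balanced[OF finite_V V_eq disjoint card_U])

lemma B_eq:
  assumes "i \<in> V" "j \<in> V"
  shows "B i j = (c - a) * of_bool (i = j) + (a + b) / 2 - (b - a) / 2 * (y i * y j)"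
  using assms by (auto simp: B_block signs_def field_simps)

text \<open>
  \<open>B\<close> is a multiple of the identity plus multiples of the projections to the all-one vector and
  to \<open>y\<close>; of the two projections only the one to \<open>y\<close> has a negative coefficient.
\<close>

lemma quad_form_B:
  "quad_form V B x = (c - a) * dotp V x x + (a + b) / 2 * (\<Sum>i\<in>V. x i)\<^sup>2
                       - (b - a) / 2 * (dotp V x y)\<^sup>2"
proof -
  have "quad_form V B x = (\<Sum>i\<in>V. \<Sum>j\<in>V. (c - a) * (if i = j then x i * x j else 0)
          + (a + b) / 2 * (x i * x j) - (b - a) / 2 * ((x i * y i) * (x j * y j)))"
    unfolding quad_form_def by (intro sum.cong refl) (simp add: B_eq algebra_simps)
  also have "\<dots> = (c - a) * (\<Sum>i\<in>V. \<Sum>j\<in>V. if i = j then x i * x j else 0)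
          + (a + b) / 2 * (\<Sum>i\<in>V. \<Sum>j\<in>V. x i * x j)
          - (b - a) / 2 * (\<Sum>i\<in>V. \<Sum>j\<in>V. (x i * y i) * (x j * y j))"
    by (simp only: sum.distrib sum_subtractf sum_distrib_left)
  also have "(\<Sum>i\<in>V. \<Sum>j\<in>V. if i = j then x i * x j else 0) = dotp V x x"
    using finite_V by (simp add: dotp_def)
  also have "(\<Sum>i\<in>V. \<Sum>j\<in>V. x i * x j) = (\<Sum>i\<in>V. x i)\<^sup>2"
    by (simp add: power2_eq_square sum_product)
  also have "(\<Sum>i\<in>V. \<Sum>j\<in>V. (x i * y i) * (x j * y j)) = (dotp V x y)\<^sup>2"
    by (simp add: power2_eq_square sum_product dotp_def)
  finally show ?thesis .
qed

lemma quad_form_close: "\<bar>quad_form V A x - quad_form V B x\<bar> \<le> \<epsilon> * D * dotp V x x"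
proof -
  have "quad_form V A x - quad_form V B x = dotp V x (mat_vec V E x)"
    by (simp add: quad_form_eq_dotp dotp_def mat_vec_def sum_subtractf left_diff_distrib
        right_diff_distrib)
  also have "\<bar>\<dots>\<bar> \<le> sqrt (dotp V x x) * (\<epsilon> * D * sqrt (dotp V x x))"
    using close[of x] \<epsilon>_pos D_pos dotp_self_nonneg[of V x]
    by (intro abs_dotp_le) (simp_all add: power_mult_distrib)
  also have "\<dots> = \<epsilon> * D * dotp V x x"
    using dotp_self_nonneg[of V x] by (simp add: mult_ac)
  finally show ?thesis .
qed

text \<open>
  Compare the minimizer with the normalized \<open>y\<close>. Both values of the quadratic form change by at most
  \<open>\<epsilon> D\<close> when \<open>A\<close> is replaced by \<open>B\<close>, while for \<open>B\<close> a unit vector exceeds the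
  minimal value by at least the gap \<open>n * (b - a) \<ge> \<delta> * D\<close> times the squared norm of its part orthogonal to
  \<open>y\<close>. For the minimizer this squared norm is therefore at most \<open>2\<epsilon> / \<delta> = \<delta> / 16\<close>.
\<close>

lemma min_unit_vector_correlation:
  assumes x: "min_unit_vector V A x"
  shows "(dotp V x y)\<^sup>2 \<ge> 2 * n * (1 - \<delta> / 16)"
proof -
  have unit: "dotp V x x = 1" and min: "\<And>z. L2_set z V = 1 \<Longrightarrow> quad_form V A x \<le> quad_form V A z"
    using x by (auto simp: min_unit_vector_def is_arg_min_def L2_set_def dotp_def power2_eq_square
      not_less)
  define t where "t = 1 / sqrt (2 * n)"
  have t2: "t\<^sup>2 * (2 * n) = 1" using n_pos by (simp add: t_def power_divide)
  define z where "z = (\<lambda>i. t * y i)"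
  have zz: "dotp V z z = 1"
    using t2 by (simp add: z_def dotp_def card_V power2_eq_square mult_ac)
  have zy: "dotp V z y = t * (2 * n)"
    by (simp add: z_def dotp_def mult.assoc card_V mult_ac)
  have z0: "(\<Sum>i\<in>V. z i) = 0" by (simp add: z_def sum_y flip: sum_distrib_left)
  have "L2_set z V = 1"
    using zz by (simp add: L2_set_def dotp_def power2_eq_square)
  hence "quad_form V A x \<le> quad_form V A z" by (rule min)
  moreover have "quad_form V A z \<le> quad_form V B z + \<epsilon> * D"
    using quad_form_close[of z] zz by simp
  moreover have "quad_form V B z = (c - a) - (b - a) * n"
  proof -
    have "(dotp V z y)\<^sup>2 = (t\<^sup>2 * (2 * n)) * (2 * n)" unfolding zy by (simp add: power2_eq_square)
    thus ?thesis unfolding quad_form_B zz z0 t2 by simp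
  qed
  moreover have "quad_form V A x \<ge> quad_form V B x - \<epsilon> * D"
    using quad_form_close[of x] unit by simp
  moreover have "quad_form V B x \<ge> (c - a) - (b - a) / 2 * (dotp V x y)\<^sup>2"
    using a_nonneg a_le_b unfolding quad_form_B unit by simp
  ultimately have "(b - a) * n - (b - a) / 2 * (dotp V x y)\<^sup>2 \<le> 2 * \<epsilon> * D" by linarith
  hence "(b - a) * n - (b - a) * n * ((dotp V x y)\<^sup>2 / (2 * n)) \<le> 2 * \<epsilon> * D"
    using n_pos by simp
  hence *: "n * (b - a) * (1 - (dotp V x y)\<^sup>2 / (2 * n)) \<le> 2 * \<epsilon> * D" by (simp add: algebra_simps)
  have "1 - (dotp V x y)\<^sup>2 / (2 * n) \<le> \<delta> / 16"
  proof (cases "0 \<le> 1 - (dotp V x y)\<^sup>2 / (2 * n)")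
    case True
    have "\<delta> * D * (1 - (dotp V x y)\<^sup>2 / (2 * n)) \<le> 2 * \<epsilon> * D"
      using mult_right_mono[OF gap True] * by linarith
    also have "\<dots> = \<delta> * D * (\<delta> / 16)" by (simp add: \<epsilon>_def power2_eq_square)
    finally show ?thesis using \<delta>_pos D_pos by simp
  qed (use \<delta>_pos in simp)
  thus ?thesis using n_pos by (simp add: field_simps)
qed

text \<open>
  The target \<open>\<tau>\<close> is a parameter, to be taken as \<open>y\<close> or \<open>- y\<close>: the algorithm cannot tell the two classes apart.
\<close>

definition wrong :: "('a \<Rightarrow> real) \<Rightarrow> 'a set \<Rightarrow> 'a set" where
  "wrong \<tau> W = {i \<in> V. signs W i \<noteq> \<tau> i}"

lemma finite_wrong: "finite (wrong \<tau> W)"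
  using finite_V by (simp add: wrong_def)

text \<open>
  Misplaced vertices contribute nothing positive to the inner product of the minimizer with the correct
  sign vector, so by the Cauchy-Schwarz inequality the square of this inner product is at most the number of vertices
  that are not misplaced.
\<close>

lemma few_wrong_initially:
  assumes x: "min_unit_vector V A x"
  shows "\<exists>\<tau>\<in>{y, \<lambda>i. - y i}. card (wrong \<tau> (color_init V x)) \<le> n * \<delta> / 8"
proof -
  have unit: "dotp V x x = 1"
    using x by (auto simp: min_unit_vector_def is_arg_min_def L2_set_def dotp_def power2_eq_square)
  \<comment> \<open>The minimizer determines the planted partition only up to exchanging the classes.\<close>
  define \<tau> where "\<tau> = (if dotp V x y \<ge> 0 then y else (\<lambda>i. - y i))"
  have \<tau>: "\<tau> \<in> {y, \<lambda>i. - y i}" by (simp add: \<tau>_def)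
  have \<tau>2: "(\<tau> i)\<^sup>2 = 1" "\<tau> i = 1 \<or> \<tau> i = -1" for i by (auto simp: \<tau>_def power2_eq_square signs_def)
  have dotp_\<tau>: "0 \<le> dotp V x \<tau>" "(dotp V x \<tau>)\<^sup>2 = (dotp V x y)\<^sup>2"
    by (auto simp: \<tau>_def dotp_def sum_negf)
  define R where "R = wrong \<tau> (color_init V x)"
  have R: "R \<subseteq> V" "finite R" using finite_wrong by (auto simp: R_def wrong_def)
  have "dotp V x \<tau> = (\<Sum>i\<in>V - R. x i * \<tau> i) + (\<Sum>i\<in>R. x i * \<tau> i)"
    unfolding dotp_def using R finite_V by (intro sum.subset_diff)
  also have "(\<Sum>i\<in>R. x i * \<tau> i) \<le> 0"
  proof (rule sum_nonpos)
    fix i assume "i \<in> R"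
    thus "x i * \<tau> i \<le> 0" using \<tau>2(2)[of i]
      by (auto simp: R_def wrong_def color_init_def signs_def split: if_splits)
  qed
  finally have "(dotp V x \<tau>)\<^sup>2 \<le> (\<Sum>i\<in>V - R. x i * \<tau> i)\<^sup>2"
    using dotp_\<tau> by (intro power_mono) auto
  also have "\<dots> \<le> (\<Sum>i\<in>V - R. (x i)\<^sup>2) * (\<Sum>i\<in>V - R. (\<tau> i)\<^sup>2)"
    by (rule Cauchy_Schwarz_ineq_sum)
  also have "\<dots> \<le> 1 * (\<Sum>i\<in>V - R. (\<tau> i)\<^sup>2)"
  proof (intro mult_right_mono sum_nonneg)
    have "(\<Sum>i\<in>V - R. (x i)\<^sup>2) \<le> dotp V x x"
      unfolding dotp_def power2_eq_square using finite_V by (intro sum_mono2) auto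
    thus "(\<Sum>i\<in>V - R. (x i)\<^sup>2) \<le> 1" using unit by simp
  qed simp
  also have "\<dots> = real (card (V - R))" by (simp add: \<tau>2)
  also have "\<dots> = 2 * n - real (card R)"
    using R finite_V card_V card_mono[OF finite_V R(1)] by (simp add: card_Diff_subset of_nat_diff)
  finally have "real (card R) \<le> 2 * n - (dotp V x y)\<^sup>2" using dotp_\<tau> by simp
  also have "\<dots> \<le> n * \<delta> / 8"
    using min_unit_vector_correlation[OF x] by (simp add: algebra_simps)
  finally show ?thesis using \<tau> by (auto simp: R_def)
qed

lemma signs_color_step:
  assumes W: "W \<subseteq> V" and i: "i \<in> V"
  shows "signs (color_step V A W) i = (if (\<Sum>j\<in>V - {i}. A i j * signs W j) < 0 then 1 else -1)"
proof -
  have "(\<Sum>j\<in>V - {i}. A i j * signs W j)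
          = (\<Sum>j\<in>W - {i}. A i j * signs W j) + (\<Sum>j\<in>(V - W) - {i}. A i j * signs W j)"
    using W finite_V by (subst sum.union_disjoint[symmetric])
      (auto intro!: sum.cong finite_subset[OF W] finite_Diff)
  also have "(\<Sum>j\<in>W - {i}. A i j * signs W j) = (\<Sum>j\<in>W - {i}. A i j)"
    by (intro sum.cong) (auto simp: signs_def)
  also have "(\<Sum>j\<in>(V - W) - {i}. A i j * signs W j) = - (\<Sum>j\<in>(V - W) - {i}. A i j)"
    unfolding sum_negf[symmetric] by (intro sum.cong) (auto simp: signs_def)
  finally show ?thesis using i by (auto simp: signs_def color_step_def)
qed

lemma abs_diag_error_le:
  assumes i: "i \<in> V"
  shows "\<bar>E i i\<bar> \<le> \<epsilon> * D"
proof (rule power2_le_imp_le)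
  have mv: "mat_vec V E (unit_vec i) l = E l i" for l
  proof -
    have "mat_vec V E (unit_vec i) l = (\<Sum>j\<in>V. if j = i then E l j else 0)"
      unfolding mat_vec_def by (intro sum.cong) (auto simp: unit_vec_def)
    thus ?thesis using i finite_V by simp
  qed
  have "dotp V (unit_vec i) (unit_vec i) = (\<Sum>j\<in>V. if j = i then 1 else 0)"
    unfolding dotp_def by (intro sum.cong) (auto simp: unit_vec_def)
  hence one: "dotp V (unit_vec i) (unit_vec i) = 1" using i finite_V by simp
  have "\<bar>E i i\<bar>\<^sup>2 = E i i * E i i" by (simp add: power2_eq_square)
  also have "\<dots> \<le> (\<Sum>l\<in>V. E l i * E l i)"
    by (rule member_le_sum[OF i]) (simp_all add: finite_V)
  also have "\<dots> = dotp V (mat_vec V E (unit_vec i)) (mat_vec V E (unit_vec i))"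
    by (simp only: dotp_def mv)
  also have "\<dots> \<le> (\<epsilon> * D)\<^sup>2" using close[of "unit_vec i"] one by simp
  finally show "\<bar>E i i\<bar>\<^sup>2 \<le> (\<epsilon> * D)\<^sup>2" .
qed (use \<epsilon>_pos D_pos in simp)

text \<open>
  With \<open>f\<close> twice the signed indicator of the misplaced vertices \<open>R\<close>, a vertex \<open>i\<close> that is misplaced
  after the step satisfies \<open>\<bar>\<Sum>j\<noteq>i. A i j * f j\<bar> \<ge> \<delta> D / 2\<close>, since \<open>f\<close> has to overcome its margin. The block
  matrix \<open>B\<close> accounts for at most half of this because \<open>R\<close> is small. Summing the rest over the newly
  misplaced set \<open>R'\<close> compares \<open>card R' * \<delta> D / 4\<close> with \<open>4 \<epsilon> D * sqrt (card R' * card R)\<close>.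
\<close>

lemma color_step_quarters_wrong:
  assumes \<tau>: "\<tau> \<in> {y, \<lambda>i. - y i}" and W: "W \<subseteq> V"
    and few: "card (wrong \<tau> W) \<le> n * \<delta> / 8"
  shows "4 * card (wrong \<tau> (color_step V A W)) \<le> card (wrong \<tau> W)"
proof -
  define R where "R = wrong \<tau> W"
  define R' where "R' = wrong \<tau> (color_step V A W)"
  have R: "R \<subseteq> V" "finite R" "R' \<subseteq> V" "finite R'"
    using finite_wrong by (auto simp: R_def R'_def wrong_def)
  have \<tau>1: "\<tau> i = 1 \<or> \<tau> i = -1" for i using \<tau> by (auto simp: signs_def split: if_splits)
  have \<tau>2: "\<tau> i * \<tau> i = 1" for i using \<tau>1[of i] by auto
  \<comment> \<open>Passing from \<open>\<tau>\<close> to the current signs changes the majority seen by a vertex by a sum against \<open>f\<close>.\<close>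
  define f where "f i = signs W i - \<tau> i" for i
  have f_abs: "\<bar>f i\<bar> = (if i \<in> R then 2 else 0)" if "i \<in> V" for i
    using \<tau>1[of i] that by (auto simp: f_def R_def wrong_def signs_def)
  have ff: "dotp V f f = (2 * sqrt (card R))\<^sup>2"
  proof -
    have "dotp V f f = (\<Sum>i\<in>V. \<bar>f i\<bar>\<^sup>2)" by (simp add: dotp_def power2_eq_square)
    also have "\<dots> = (\<Sum>i\<in>V. if i \<in> R then 4 else 0)" by (intro sum.cong refl) (simp add: f_abs)
    also have "\<dots> = (\<Sum>i\<in>R. 4)" using R finite_V by (intro sum.mono_neutral_cong_right) auto
    finally show ?thesis by (simp add: power_mult_distrib)
  qed
  have pointwise: "\<delta> * D / 4 \<le> \<tau> i * mat_vec V E f i + \<epsilon> * D * \<bar>f i\<bar>" if i: "i \<in> R'" for i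
  proof -
    have iV: "i \<in> V" using i R by blast
    have "0 \<le> \<tau> i * (\<Sum>j\<in>V - {i}. A i j * signs W j)"
      using i \<tau>1[of i] iV signs_color_step[OF W iV]
      by (auto simp: R'_def wrong_def split: if_splits)
    moreover have "\<tau> i * (\<Sum>j\<in>V - {i}. A i j * \<tau> j) \<le> - (\<delta> / 2 * D)"
      using \<tau> margin[OF iV] by (auto simp: sum_negf)
    moreover have "(\<Sum>j\<in>V - {i}. A i j * f j)
        = (\<Sum>j\<in>V - {i}. A i j * signs W j) - (\<Sum>j\<in>V - {i}. A i j * \<tau> j)"
      by (simp add: f_def right_diff_distrib sum_subtractf)
    ultimately have "\<delta> / 2 * D \<le> \<tau> i * (\<Sum>j\<in>V - {i}. A i j * f j)"
      by (simp add: right_diff_distrib)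
    also have "(\<Sum>j\<in>V - {i}. A i j * f j)
        = mat_vec V E f i - E i i * f i + (\<Sum>j\<in>V - {i}. B i j * f j)"
    proof -
      have "mat_vec V E f i = E i i * f i + (\<Sum>j\<in>V - {i}. E i j * f j)"
        unfolding mat_vec_def by (rule sum.remove[OF finite_V iV])
      thus ?thesis by (simp add: left_diff_distrib sum_subtractf)
    qed
    also have "\<tau> i * \<dots> \<le> \<tau> i * mat_vec V E f i + \<bar>E i i * f i\<bar> + \<bar>\<Sum>j\<in>V - {i}. B i j * f j\<bar>"
      using \<tau>1[of i] by auto
    also have "\<bar>E i i * f i\<bar> \<le> \<epsilon> * D * \<bar>f i\<bar>"
      unfolding abs_mult by (intro mult_right_mono abs_diag_error_le iV) simp
    also have "\<bar>\<Sum>j\<in>V - {i}. B i j * f j\<bar> \<le> \<delta> * D / 4"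
    proof -
      have "\<bar>\<Sum>j\<in>V - {i}. B i j * f j\<bar> \<le> (\<Sum>j\<in>V - {i}. b * \<bar>f j\<bar>)"
      proof (intro order.trans[OF sum_abs] sum_mono)
        fix j assume j: "j \<in> V - {i}"
        have "\<bar>B i j\<bar> \<le> b" using j iV a_nonneg a_le_b by (auto simp: B_block)
        thus "\<bar>B i j * f j\<bar> \<le> b * \<bar>f j\<bar>" by (simp add: abs_mult mult_right_mono)
      qed
      also have "\<dots> \<le> (\<Sum>j\<in>V. b * \<bar>f j\<bar>)"
        using finite_V a_nonneg a_le_b by (intro sum_mono2) auto
      also have "\<dots> = (\<Sum>j\<in>V. if j \<in> R then b * 2 else 0)" by (intro sum.cong refl) (simp add: f_abs)
      also have "\<dots> = (\<Sum>j\<in>R. b * 2)" using R finite_V by (intro sum.mono_neutral_cong_right) auto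
      also have "\<dots> = 2 * b * card R" by simp
      also have "\<dots> \<le> 2 * b * (n * \<delta> / 8)"
        using few a_nonneg a_le_b by (intro mult_left_mono) (auto simp: R_def)
      also have "\<dots> = (n * b) * \<delta> / 4" by simp
      also have "\<dots> \<le> D * \<delta> / 4" using b_le \<delta>_pos by (intro divide_right_mono mult_right_mono) auto
      finally show ?thesis by (simp add: mult_ac)
    qed
    finally show ?thesis by (simp add: algebra_simps)
  qed
  define g where "g i = (if i \<in> R' then \<tau> i else 0)" for i
  define h where "h i = (if i \<in> R' then 1 else 0 :: real)" for i
  have gg: "dotp V g g = (sqrt (card R'))\<^sup>2" and hh: "dotp V h h = (sqrt (card R'))\<^sup>2"
  proof -
    have "dotp V g g = (\<Sum>i\<in>V. if i \<in> R' then 1 else 0)"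
      unfolding dotp_def by (intro sum.cong refl) (simp add: g_def \<tau>2)
    also have "\<dots> = (\<Sum>i\<in>R'. 1)" using R finite_V by (intro sum.mono_neutral_cong_right) auto
    finally show "dotp V g g = (sqrt (card R'))\<^sup>2" by simp
    have "dotp V h h = (\<Sum>i\<in>V. if i \<in> R' then 1 else 0)"
      unfolding dotp_def by (intro sum.cong refl) (simp add: h_def)
    also have "\<dots> = (\<Sum>i\<in>R'. 1)" using R finite_V by (intro sum.mono_neutral_cong_right) auto
    finally show "dotp V h h = (sqrt (card R'))\<^sup>2" by simp
  qed
  have "card R' * (\<delta> * D / 4) = (\<Sum>i\<in>R'. \<delta> * D / 4)" by simp
  also have "\<dots> \<le> (\<Sum>i\<in>R'. \<tau> i * mat_vec V E f i + \<epsilon> * D * \<bar>f i\<bar>)"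
    by (intro sum_mono pointwise)
  also have "\<dots> = (\<Sum>i\<in>V. g i * mat_vec V E f i + \<epsilon> * D * (h i * \<bar>f i\<bar>))"
    using R finite_V by (intro sum.mono_neutral_cong_left) (auto simp: g_def h_def)
  also have "\<dots> = dotp V g (mat_vec V E f) + \<epsilon> * D * dotp V h (\<lambda>i. \<bar>f i\<bar>)"
    by (simp add: dotp_def sum.distrib sum_distrib_left)
  also have "dotp V g (mat_vec V E f) \<le> sqrt (card R') * (\<epsilon> * D * (2 * sqrt (card R)))"
  proof -
    have "\<bar>dotp V g (mat_vec V E f)\<bar> \<le> sqrt (card R') * (\<epsilon> * D * (2 * sqrt (card R)))"
      using close[of f] gg \<epsilon>_pos D_pos by (intro abs_dotp_le) (simp_all add: ff power_mult_distrib)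
    thus ?thesis by simp
  qed
  also have "dotp V h (\<lambda>i. \<bar>f i\<bar>) \<le> sqrt (card R') * (2 * sqrt (card R))"
  proof -
    have "dotp V (\<lambda>i. \<bar>f i\<bar>) (\<lambda>i. \<bar>f i\<bar>) = dotp V f f" by (simp add: dotp_def)
    hence "\<bar>dotp V h (\<lambda>i. \<bar>f i\<bar>)\<bar> \<le> sqrt (card R') * (2 * sqrt (card R))"
      using hh ff by (intro abs_dotp_le) simp_all
    thus ?thesis by simp
  qed
  finally have "card R' * (\<delta> * D / 4) \<le> 4 * \<epsilon> * D * (sqrt (card R') * sqrt (card R))"
    using \<epsilon>_pos D_pos by (simp add: mult_ac)
  hence "D * \<delta> * (sqrt (card R') * sqrt (card R')) \<le> D * \<delta> * (\<delta> / 2 * (sqrt (card R') * sqrt (card R)))"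
    by (simp add: \<epsilon>_def power2_eq_square mult_ac)
  hence *: "sqrt (card R') * sqrt (card R') \<le> \<delta> / 2 * (sqrt (card R') * sqrt (card R))"
    using D_pos \<delta>_pos by (simp only: mult_le_cancel_left_pos mult_pos_pos)
  also have "\<dots> \<le> 1 / 2 * (sqrt (card R') * sqrt (card R))"
    using \<delta>_le by (intro mult_right_mono) auto
  finally have **: "sqrt (card R') * sqrt (card R') \<le> sqrt (card R') * (1 / 2 * sqrt (card R))" by simp
  have "sqrt (card R') \<le> 1 / 2 * sqrt (card R)"
  proof (cases "card R' = 0")
    case False
    hence "0 < sqrt (card R')" by simp
    thus ?thesis using ** by (simp only: mult_le_cancel_left_pos)
  qed simp
  hence "(2 * sqrt (card R'))\<^sup>2 \<le> (sqrt (card R))\<^sup>2" by (intro power_mono) auto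
  hence "4 * real (card R') \<le> real (card R)" by (simp add: power_mult_distrib)
  thus ?thesis by (simp add: R_def R'_def)
qed

lemma color_steps_wrong:
  assumes \<tau>: "\<tau> \<in> {y, \<lambda>i. - y i}" and W: "W \<subseteq> V" and few: "card (wrong \<tau> W) \<le> n * \<delta> / 8"
  shows "(color_step V A ^^ t) W \<subseteq> V \<and>
         4 ^ t * card (wrong \<tau> ((color_step V A ^^ t) W)) \<le> card (wrong \<tau> W)"
proof (induction t)
  case (Suc t)
  let ?W = "(color_step V A ^^ t) W"
  have "card (wrong \<tau> ?W) \<le> 4 ^ t * card (wrong \<tau> ?W)" by simp
  hence le: "card (wrong \<tau> ?W) \<le> card (wrong \<tau> W)" using Suc.IH by linarith
  hence "4 * card (wrong \<tau> (color_step V A ?W)) \<le> card (wrong \<tau> ?W)"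
    using Suc.IH few by (intro color_step_quarters_wrong \<tau>) auto
  hence "4 ^ t * (4 * card (wrong \<tau> (color_step V A ?W))) \<le> 4 ^ t * card (wrong \<tau> ?W)"
    by (rule mult_left_mono) simp
  also have "\<dots> \<le> card (wrong \<tau> W)" using Suc.IH by simp
  finally have "4 ^ Suc t * card (wrong \<tau> (color_step V A ?W)) \<le> card (wrong \<tau> W)"
    by (simp add: mult_ac)
  moreover have "color_step V A ?W \<subseteq> V" by (auto simp: color_step_def)
  ultimately show ?case by simp
qed (use W in simp)

theorem finds_planted_classes:
  assumes x: "min_unit_vector V A x" and t: "real n \<le> 2 ^ t"
  shows "(color_step V A ^^ t) (color_init V x) \<in> {U1, U2}"
proof -
  obtain \<tau> where \<tau>: "\<tau> \<in> {y, \<lambda>i. - y i}" and few: "card (wrong \<tau> (color_init V x)) \<le> n * \<delta> / 8"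
    using few_wrong_initially[OF x] by blast
  let ?W = "(color_step V A ^^ t) (color_init V x)"
  have steps: "?W \<subseteq> V" "4 ^ t * card (wrong \<tau> ?W) \<le> card (wrong \<tau> (color_init V x))"
    using color_steps_wrong[OF \<tau> _ few, of t] by (auto simp: color_init_def)
  have "card (wrong \<tau> ?W) = 0"
  proof (rule ccontr)
    assume "card (wrong \<tau> ?W) \<noteq> 0"
    hence "(4::nat) ^ t * 1 \<le> 4 ^ t * card (wrong \<tau> ?W)" by (intro mult_left_mono) auto
    hence "(4::nat) ^ t \<le> card (wrong \<tau> (color_init V x))" using steps(2) by linarith
    hence "real (4 ^ t) \<le> card (wrong \<tau> (color_init V x))" by (rule of_nat_mono)
    hence "real (4 ^ t) \<le> n * \<delta> / 8" using few by linarith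
    hence "4 ^ t \<le> n * \<delta> / 8" by simp
    also have "\<dots> \<le> real n * 1 / 8" using \<delta>_le by (intro divide_right_mono mult_left_mono) auto
    also have "\<dots> < n" using n_pos by simp
    also have "\<dots> \<le> 2 ^ t" by (rule t)
    also have "\<dots> \<le> 4 ^ t" by (intro power_mono) auto
    finally show False by simp
  qed
  hence none: "wrong \<tau> ?W = {}" using finite_wrong by simp
  hence eq: "signs ?W i = \<tau> i" if "i \<in> V" for i using that by (auto simp: wrong_def)
  from \<tau> show ?thesis
  proof
    assume "\<tau> = y"
    hence "i \<in> ?W \<longleftrightarrow> i \<in> U1" if "i \<in> V" for i
      using eq[OF that] by (simp add: signs_def split: if_splits)
    hence "?W = U1" using steps(1) V_eq by blast
    thus ?thesis by simp
  next
    assume "\<tau> \<in> {\<lambda>i. - y i}"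
    hence "i \<in> ?W \<longleftrightarrow> i \<notin> U1" if "i \<in> V" for i
      using eq[OF that] by (simp add: signs_def split: if_splits)
    hence "?W = U2" using steps(1) V_eq disjoint by blast
    thus ?thesis by simp
  qed
qed

end

section \<open>The random bipartite hypergraph\<close>

lemma card_subsets_containing:
  assumes "finite W" "S \<subseteq> W" "card S \<le> m"
  shows "card {e. S \<subseteq> e \<and> e \<subseteq> W \<and> card e = m} = (card W - card S) choose (m - card S)"
proof -
  have S: "finite S" using assms finite_subset by blast
  have "bij_betw (\<lambda>e. e \<union> S) {e. e \<subseteq> W - S \<and> card e = m - card S} {e. S \<subseteq> e \<and> e \<subseteq> W \<and> card e = m}"
  proof (rule bij_betwI[where g = "\<lambda>e. e - S"])
    show "(\<lambda>e. e \<union> S) \<in> {e. e \<subseteq> W - S \<and> card e = m - card S} \<rightarrow> {e. S \<subseteq> e \<and> e \<subseteq> W \<and> card e = m}"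
    proof
      fix e assume e: "e \<in> {e. e \<subseteq> W - S \<and> card e = m - card S}"
      hence "finite e" using assms(1) finite_subset by blast
      hence "card (e \<union> S) = card e + card S" using e S by (intro card_Un_disjoint) auto
      thus "e \<union> S \<in> {e. S \<subseteq> e \<and> e \<subseteq> W \<and> card e = m}" using e assms by auto
    qed
    show "(\<lambda>e. e - S) \<in> {e. S \<subseteq> e \<and> e \<subseteq> W \<and> card e = m} \<rightarrow> {e. e \<subseteq> W - S \<and> card e = m - card S}"
      using S by (auto simp: card_Diff_subset)
  qed auto
  hence "card {e. S \<subseteq> e \<and> e \<subseteq> W \<and> card e = m} = card {e. e \<subseteq> W - S \<and> card e = m - card S}"
    by (simp add: bij_betw_same_card)
  also have "\<dots> = card (W - S) choose (m - card S)"
    using assms(1) by (intro n_subsets) auto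
  also have "card (W - S) = card W - card S" using S assms by (intro card_Diff_subset)
  finally show ?thesis .
qed

text \<open>
  Both sides are of order \<open>n ^ (m - 1)\<close>; the bound \<open>K\<close> on the edge sizes is what keeps their ratio
  bounded.
\<close>

lemma cross_binomial_lower_bound:
  assumes m: "2 \<le> m" "m \<le> K" and n: "K \<le> n"
  shows "real ((2 * n - 1) choose (m - 1)) / real ((2 * K) ^ K)
           \<le> real n * (real ((n - 2) choose (m - 2)) / real m)"
proof -
  have n0: "0 < n" "0 < K" using m n by auto
  have "real ((2 * n - 1) choose (m - 1)) \<le> real ((2 * n - 1) ^ (m - 1))"
    using m n by (intro of_nat_mono binomial_le_pow) auto
  also have "\<dots> \<le> real ((2 * n) ^ (m - 1))" by (intro of_nat_mono power_mono) auto
  finally have up: "real ((2 * n - 1) choose (m - 1)) \<le> (2 * real n) ^ (m - 1)" by simp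
  have "(real n / real m) ^ (m - 2) \<le> (real (n - 2) / real (m - 2)) ^ (m - 2)"
  proof (cases "m = 2")
    case False
    hence m2: "0 < real (m - 2)" "real (m - 2) = real m - 2" "real (n - 2) = real n - 2"
      using m n by auto
    have "real n / real m \<le> real (n - 2) / real (m - 2)"
      using m n m2 by (simp add: field_simps)
    thus ?thesis by (intro power_mono) auto
  qed simp
  also have "\<dots> \<le> real ((n - 2) choose (m - 2))"
    using m n by (intro binomial_ge_n_over_k_pow_k) auto
  finally have low: "(real n / real m) ^ (m - 2) \<le> real ((n - 2) choose (m - 2))" .
  have "real ((2 * n - 1) choose (m - 1)) / real ((2 * K) ^ K)
          \<le> (2 * real n) ^ (m - 1) / (2 * real K) ^ (m - 1)"
  proof (intro frac_le up)
    have "(2 * real K) ^ (m - 1) \<le> (2 * real K) ^ K" using m n0 by (intro power_increasing) auto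
    thus "(2 * real K) ^ (m - 1) \<le> real ((2 * K) ^ K)" by simp
  qed (use n0 in auto)
  also have "\<dots> = (real n / real K) ^ (m - 1)" by (simp flip: power_divide)
  also have "\<dots> \<le> (real n / real m) ^ (m - 1)"
    using m n0 by (intro power_mono divide_left_mono) auto
  also have "\<dots> = real n * ((real n / real m) ^ (m - 2) / real m)"
  proof -
    have "m - 1 = Suc (m - 2)" using m by simp
    hence "(real n / real m) ^ (m - 1) = (real n / real m) * (real n / real m) ^ (m - 2)" by simp
    thus ?thesis by simp
  qed
  also have "\<dots> \<le> real n * (real ((n - 2) choose (m - 2)) / real m)"
    by (intro mult_left_mono divide_right_mono low) auto
  finally show ?thesis .
qed

locale planted_hypergraph =
  fixes n M K :: nat and p :: "nat \<Rightarrow> real" and U1 U2 :: "nat set"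
  assumes split: "planted_split n U1 U2"
    and M: "2 \<le> M" "M \<le> K"
    and p01: "\<And>m. m \<in> {2..M} \<Longrightarrow> 0 \<le> p m \<and> p m \<le> 1"
    and n: "K \<le> n"
begin

abbreviation V :: "nat set" where "V \<equiv> {1..2 * n}"

abbreviation q :: "nat set \<Rightarrow> real" where "q \<equiv> edge_prob U1 U2 M p"

text \<open>
  An upper bound for the expected degree of a vertex that ignores the ban on monochromatic edges.
  It is of the same order as the expected degree, and unlike it directly comparable with the density
  in the theorem.
\<close>

definition D :: real where
  "D = (\<Sum>m=2..M. p m * real ((2 * n - 1) choose (m - 1)))"

definition N :: "nat set \<Rightarrow> nat \<Rightarrow> nat" where
  "N S m = card {e. e \<subseteq> V \<and> S \<subseteq> e \<and> \<not> monochromatic U1 U2 e \<and> card e = m}"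

lemma U: "V = U1 \<union> U2" "U1 \<inter> U2 = {}" "card U1 = n" "card U2 = n" "finite U1" "finite U2"
proof -
  show "V = U1 \<union> U2" "U1 \<inter> U2 = {}" "card U1 = n" "card U2 = n"
    using split by (auto simp: planted_split_def)
  hence "finite (U1 \<union> U2)" by (metis finite_atLeastAtMost)
  thus "finite U1" "finite U2" by auto
qed

lemma n2: "2 \<le> n" using M n by simp

lemma sum_q_containing:
  "(\<Sum>e | e \<in> Pow V \<and> S \<subseteq> e. q e * g (card e)) = (\<Sum>m=2..M. p m * g m * real (N S m))"
proof -
  let ?E = "{e. e \<subseteq> V \<and> S \<subseteq> e \<and> \<not> monochromatic U1 U2 e \<and> card e \<in> {2..M}}"
  have fin: "finite ?E" by (rule finite_subset[of _ "Pow V"]) auto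
  have "(\<Sum>e | e \<in> Pow V \<and> S \<subseteq> e. q e * g (card e)) = (\<Sum>e\<in>?E. p (card e) * g (card e))"
    by (intro sum.mono_neutral_cong_right) (auto simp: edge_prob_def)
  also have "\<dots> = (\<Sum>m\<in>{2..M}. \<Sum>e | e \<in> ?E \<and> card e = m. p (card e) * g (card e))"
    by (intro sum.group[symmetric] fin) auto
  also have "\<dots> = (\<Sum>m\<in>{2..M}. p m * g m * real (N S m))"
  proof (intro sum.cong refl)
    fix m assume m: "m \<in> {2..M}"
    hence eq: "{e. e \<in> ?E \<and> card e = m} = {e. e \<subseteq> V \<and> S \<subseteq> e \<and> \<not> monochromatic U1 U2 e \<and> card e = m}"
      by auto
    have "(\<Sum>e | e \<in> ?E \<and> card e = m. p (card e) * g (card e)) = (\<Sum>e | e \<in> ?E \<and> card e = m. p m * g m)"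
      by (intro sum.cong) auto
    also have "\<dots> = p m * g m * real (N S m)" unfolding eq N_def by simp
    finally show "(\<Sum>e | e \<in> ?E \<and> card e = m. p (card e) * g (card e)) = p m * g m * real (N S m)" .
  qed
  finally show ?thesis .
qed

lemma N_eq:
  assumes S: "S \<subseteq> V" "S \<noteq> {}" "card S \<le> m"
  shows "real (N S m) = real ((2 * n - card S) choose (m - card S))
           - (if S \<subseteq> U1 \<or> S \<subseteq> U2 then real ((n - card S) choose (m - card S)) else 0)"
proof -
  let ?all = "{e. S \<subseteq> e \<and> e \<subseteq> V \<and> card e = m}"
  let ?mono = "\<lambda>W. {e. S \<subseteq> e \<and> e \<subseteq> W \<and> card e = m}"
  let ?non = "{e. e \<subseteq> V \<and> S \<subseteq> e \<and> \<not> monochromatic U1 U2 e \<and> card e = m}"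
  define c where "c = (n - card S) choose (m - card S)"
  have fin: "finite X" if "X \<subseteq> Pow V" for X using that finite_subset by blast
  have fins: "finite ?non" "finite (?mono U1)" "finite (?mono U2)"
    by (rule fin, use U(1) in blast)+
  have all: "?all = ?non \<union> (?mono U1 \<union> ?mono U2)"
    using U(1) by (auto simp: monochromatic_def)
  have disj: "?non \<inter> (?mono U1 \<union> ?mono U2) = {}" by (auto simp: monochromatic_def)
  have disj': "?mono U1 \<inter> ?mono U2 = {}" using S(2) U(2) by blast
  have "card ?all = card ?non + card (?mono U1 \<union> ?mono U2)"
    by (subst all, rule card_Un_disjoint) (intro finite_UnI fins disj)+
  also have "card (?mono U1 \<union> ?mono U2) = card (?mono U1) + card (?mono U2)"
    by (intro card_Un_disjoint fins disj')
  finally have split_all: "card ?all = card ?non + (card (?mono U1) + card (?mono U2))" .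
  have all_card: "card ?all = (2 * n - card S) choose (m - card S)"
    using card_subsets_containing[of V S m] S by simp
  have mono_card: "card (?mono W) = (if S \<subseteq> W then c else 0)"
    if "finite W" "card W = n" for W
  proof (cases "S \<subseteq> W")
    case True
    thus ?thesis using card_subsets_containing[of W S m] that S(3) by (simp only: c_def if_True)
  next
    case False
    hence "?mono W = {}" by blast
    hence "card (?mono W) = 0" by (simp only: card.empty)
    thus ?thesis by (simp only: False if_False)
  qed
  have "N S m + ((if S \<subseteq> U1 then c else 0) + (if S \<subseteq> U2 then c else 0))
          = (2 * n - card S) choose (m - card S)"
    using split_all unfolding all_card mono_card[OF U(5,3)] mono_card[OF U(6,4)] N_def by (rule sym)
  hence "real (N S m) + ((if S \<subseteq> U1 then real c else 0) + (if S \<subseteq> U2 then real c else 0))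
          = real ((2 * n - card S) choose (m - card S))"
    unfolding of_nat_eq_iff[where 'a = real, symmetric] of_nat_add if_distrib[of real] of_nat_0 .
  moreover have "\<not> (S \<subseteq> U1 \<and> S \<subseteq> U2)" using S(2) U(2) by blast
  ultimately show ?thesis unfolding c_def[symmetric] by (auto split: if_splits)
qed

lemma D_nonneg: "0 \<le> D"
  unfolding D_def using p01 by (intro sum_nonneg) auto

sublocale random_hypermatrix "Pow V" q V D
proof
  show "0 \<le> q e" "q e \<le> 1" for e using p01 by (auto simp: edge_prob_def)
  fix i assume i: "i \<in> V"
  have "(\<Sum>e | e \<in> Pow V \<and> i \<in> e. q e) = (\<Sum>e | e \<in> Pow V \<and> {i} \<subseteq> e. q e * 1)" by simp
  also have "\<dots> = (\<Sum>m=2..M. p m * 1 * real (N {i} m))" by (rule sum_q_containing)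
  also have "\<dots> \<le> D"
    unfolding D_def
  proof (rule sum_mono)
    fix m assume m: "m \<in> {2..M}"
    have "real (N {i} m) \<le> real ((2 * n - 1) choose (m - 1))"
      using N_eq[of "{i}" m] i m by auto
    thus "p m * 1 * real (N {i} m) \<le> p m * real ((2 * n - 1) choose (m - 1))"
      using p01[OF m] by (simp add: mult_left_mono)
  qed
  finally show "(\<Sum>e | e \<in> Pow V \<and> i \<in> e. q e) \<le> D" .
qed (use D_nonneg in auto)

definition mean :: "nat \<Rightarrow> nat \<Rightarrow> real" where
  "mean i j = (\<Sum>e | e \<in> Pow V \<and> i \<in> e \<and> j \<in> e. q e / real (card e))"

definition mean_diag :: real where
  "mean_diag = (\<Sum>m=2..M. p m / m * (real ((2 * n - 1) choose (m - 1)) - real ((n - 1) choose (m - 1))))"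

definition mean_same :: real where
  "mean_same = (\<Sum>m=2..M. p m / m * (real ((2 * n - 2) choose (m - 2)) - real ((n - 2) choose (m - 2))))"

definition mean_cross :: real where
  "mean_cross = (\<Sum>m=2..M. p m / m * real ((2 * n - 2) choose (m - 2)))"

lemma mean_block:
  assumes "i \<in> V" "j \<in> V"
  shows "mean i j = (if i = j then mean_diag else if (i \<in> U1) = (j \<in> U1) then mean_same else mean_cross)"
proof -
  have "mean i j = (\<Sum>e | e \<in> Pow V \<and> {i, j} \<subseteq> e. q e * (1 / real (card e)))"
    unfolding mean_def by (intro sum.cong) auto
  also have "\<dots> = (\<Sum>m=2..M. p m * (1 / real m) * real (N {i, j} m))" by (rule sum_q_containing)
  finally have mean: "mean i j = (\<Sum>m=2..M. p m / real m * real (N {i, j} m))" by simp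
  have mem: "x \<in> U2 \<longleftrightarrow> x \<notin> U1" if "x \<in> V" for x using that U by blast
  show ?thesis
  proof (cases "i = j")
    case True
    have "real (N {i, j} m) = real ((2 * n - 1) choose (m - 1)) - real ((n - 1) choose (m - 1))"
      if "m \<in> {2..M}" for m
      using N_eq[of "{i}" m] assms mem that True by auto
    hence "mean i j = mean_diag" unfolding mean mean_diag_def by (intro sum.cong refl) simp
    thus ?thesis using True by simp
  next
    case False
    have N: "real (N {i, j} m) = real ((2 * n - 2) choose (m - 2))
        - (if (i \<in> U1) = (j \<in> U1) then real ((n - 2) choose (m - 2)) else 0)" if "m \<in> {2..M}" for m
      using N_eq[of "{i, j}" m] assms mem[of i] mem[of j] that False by (auto simp: numeral_2_eq_2)
    show ?thesis using False N by (simp add: mean mean_same_def mean_cross_def)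
  qed
qed

lemma mean_same_nonneg: "0 \<le> mean_same"
  unfolding mean_same_def using p01
  by (intro sum_nonneg mult_nonneg_nonneg) (auto simp: binomial_right_mono)

text \<open>
  The row sums of the mean matrix are expected degrees, and \<open>n * mean_cross\<close> is the part of a row sum
  that belongs to the other class.
\<close>

lemma mean_cross_le: "n * mean_cross \<le> D"
  unfolding mean_cross_def D_def sum_distrib_left
proof (rule sum_mono)
  fix m assume m: "m \<in> {2..M}"
  have "(m - 1) * ((2 * n - 1) choose (m - 1)) = (2 * n - 1) * ((2 * n - 2) choose (m - 2))"
    using times_binomial_minus1_eq[of "m - 1" "2 * n - 1"] m by (simp add: numeral_2_eq_2)
  hence "real (m - 1) * real ((2 * n - 1) choose (m - 1)) = real (2 * n - 1) * real ((2 * n - 2) choose (m - 2))"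
    by (simp only: flip: of_nat_mult)
  moreover have "real n * real ((2 * n - 2) choose (m - 2)) \<le> real (2 * n - 1) * real ((2 * n - 2) choose (m - 2))"
    using n2 by (intro mult_right_mono) auto
  moreover have "real (m - 1) * real ((2 * n - 1) choose (m - 1)) \<le> real m * real ((2 * n - 1) choose (m - 1))"
    by (intro mult_right_mono) auto
  ultimately have "real n * real ((2 * n - 2) choose (m - 2)) / m \<le> real ((2 * n - 1) choose (m - 1))"
    using m by (simp add: field_simps)
  hence "p m * (real n * real ((2 * n - 2) choose (m - 2)) / m) \<le> p m * real ((2 * n - 1) choose (m - 1))"
    using p01[OF m] by (intro mult_left_mono) auto
  thus "real n * (p m / m * real ((2 * n - 2) choose (m - 2))) \<le> p m * real ((2 * n - 1) choose (m - 1))"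
    by (simp add: mult_ac)
qed

definition \<delta> :: real where "\<delta> = 1 / real ((2 * K) ^ K)"

lemma \<delta>: "0 < \<delta>" "\<delta> \<le> 1"
proof -
  have "1 \<le> (2 * K) ^ K" using M by (intro one_le_power) simp
  hence one: "1 \<le> real ((2 * K) ^ K)" by (metis of_nat_1 of_nat_le_iff)
  hence "0 < real ((2 * K) ^ K)" by linarith
  thus "0 < \<delta>" "\<delta> \<le> 1"
    using one by (simp_all only: \<delta>_def zero_less_divide_1_iff divide_le_eq_1_pos)
qed

text \<open>
  The difference \<open>mean_cross - mean_same\<close> is carried by the sets that contain two given vertices of one
  class and lie inside this class.
\<close>

lemma mean_gap: "\<delta> * D \<le> n * (mean_cross - mean_same)"
proof -
  have "\<delta> * D = (\<Sum>m=2..M. p m * (real ((2 * n - 1) choose (m - 1)) / real ((2 * K) ^ K)))"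
    by (simp add: \<delta>_def D_def sum_divide_distrib)
  also have "\<dots> \<le> (\<Sum>m=2..M. p m * (real n * (real ((n - 2) choose (m - 2)) / real m)))"
    using p01 M n by (intro sum_mono mult_left_mono cross_binomial_lower_bound) auto
  also have "\<dots> = n * (mean_cross - mean_same)"
    unfolding mean_cross_def mean_same_def sum_subtractf[symmetric] sum_distrib_left
    by (intro sum.cong refl) (simp add: algebra_simps)
  finally show ?thesis .
qed

abbreviation edges :: "(nat set \<Rightarrow> bool) \<Rightarrow> nat set set" where
  "edges f \<equiv> {e \<in> Pow V. f e}"

lemma hyper_matrix_edges:
  "hyper_matrix (edges f) i j = (\<Sum>e | e \<in> Pow V \<and> i \<in> e \<and> j \<in> e. of_bool (f e) / real (card e))"
  unfolding hyper_matrix_def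
  by (intro sum.mono_neutral_cong_left) (auto intro: finite_subset[of _ "Pow V"])

lemma hyper_matrix_minus_mean: "hyper_matrix (edges f) i j - mean i j = fluct f i j"
  unfolding hyper_matrix_edges mean_def fluct_def \<eta>_def
  by (simp add: diff_divide_distrib flip: sum_subtractf)

abbreviation side :: "nat \<Rightarrow> real" where "side \<equiv> signs U1"

text \<open>
  The contribution of an edge \<open>e\<close> to the majority seen by \<open>i\<close>, counted positively for vertices in the
  class of \<open>i\<close>.
\<close>

definition balance :: "nat \<Rightarrow> nat set \<Rightarrow> real" where
  "balance i e = (if i \<in> e then side i * (\<Sum>j\<in>e - {i}. side j) / real (card e) else 0)"

lemma abs_balance_le:
  assumes "e \<in> Pow V"
  shows "\<bar>balance i e\<bar> \<le> 1"
proof (cases "i \<in> e")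
  case True
  have fin: "finite e" using assms finite_subset by auto
  have "\<bar>\<Sum>j\<in>e - {i}. side j\<bar> \<le> (\<Sum>j\<in>e - {i}. 1)"
    by (intro order.trans[OF sum_abs] sum_mono) (simp add: signs_def)
  also have "\<dots> \<le> real (card e)" using fin by (simp add: card_Diff1_le)
  finally have "\<bar>side i * (\<Sum>j\<in>e - {i}. side j)\<bar> \<le> real (card e)" by (simp add: abs_mult signs_def)
  moreover have "0 < card e" using True fin card_gt_0_iff by blast
  ultimately show ?thesis using True by (simp add: balance_def)
qed (simp add: balance_def)

lemma weighted_neighbour_sum:
  assumes i: "i \<in> V"
  shows "side i * (\<Sum>j\<in>V - {i}. (\<Sum>e | e \<in> Pow V \<and> i \<in> e \<and> j \<in> e. h e / real (card e)) * side j)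
           = (\<Sum>e\<in>Pow V. h e * balance i e)"
proof -
  have "(\<Sum>e | e \<in> Pow V \<and> i \<in> e \<and> j \<in> e. h e / real (card e)) * side j
          = (\<Sum>e\<in>Pow V. if i \<in> e \<and> j \<in> e then h e / real (card e) * side j else 0)" for j
    unfolding sum_distrib_right by (intro sum.mono_neutral_cong_left) auto
  hence "(\<Sum>j\<in>V - {i}. (\<Sum>e | e \<in> Pow V \<and> i \<in> e \<and> j \<in> e. h e / real (card e)) * side j)
          = (\<Sum>e\<in>Pow V. \<Sum>j\<in>V - {i}. if i \<in> e \<and> j \<in> e then h e / real (card e) * side j else 0)"
    by (simp only: sum.swap[of _ "Pow V"])
  also have "side i * \<dots> = (\<Sum>e\<in>Pow V. h e * balance i e)"
    unfolding sum_distrib_left[of "side i" _ "Pow V"]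
  proof (intro sum.cong refl)
    fix e assume e: "e \<in> Pow V"
    show "side i * (\<Sum>j\<in>V - {i}. if i \<in> e \<and> j \<in> e then h e / real (card e) * side j else 0) = h e * balance i e"
    proof (cases "i \<in> e")
      case True
      have "(\<Sum>j\<in>V - {i}. if i \<in> e \<and> j \<in> e then h e / real (card e) * side j else 0)
              = (\<Sum>j\<in>e - {i}. h e / real (card e) * side j)"
        using e True by (intro sum.mono_neutral_cong_right) auto
      thus ?thesis using True by (simp add: balance_def sum_distrib_left sum_divide_distrib mult_ac)
    qed (simp add: balance_def)
  qed
  finally show ?thesis .
qed

lemma mean_margin:
  assumes i: "i \<in> V"
  shows "side i * (\<Sum>j\<in>V - {i}. mean i j * side j) \<le> - (\<delta> * D)"
proof -
  have "side i * (\<Sum>j\<in>V - {i}. mean i j * side j)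
          = (\<Sum>j\<in>V - {i}. (mean_same + mean_cross) / 2 * (side i * side j) - (mean_cross - mean_same) / 2)"
    unfolding sum_distrib_left using i
    by (intro sum.cong refl) (auto simp: mean_block signs_def field_simps)
  also have "\<dots> = (mean_same + mean_cross) / 2 * (side i * (\<Sum>j\<in>V - {i}. side j))
                 - real (card (V - {i})) * ((mean_cross - mean_same) / 2)"
    by (simp add: sum_subtractf sum_distrib_left)
  also have "side i * (\<Sum>j\<in>V - {i}. side j) = - 1"
  proof -
    have "(\<Sum>j\<in>V. side j) = 0" using U by (intro sum_signs_balanced) auto
    hence "(\<Sum>j\<in>V - {i}. side j) = - side i" using i by (simp add: sum_diff1)
    thus ?thesis by simp
  qed
  also have "real (card (V - {i})) = 2 * real n - 1" using i n2 by simp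
  finally have "side i * (\<Sum>j\<in>V - {i}. mean i j * side j) = - mean_same - n * (mean_cross - mean_same)"
    by (simp add: field_simps)
  thus ?thesis using mean_gap mean_same_nonneg by linarith
qed

definition margin_ok :: "(nat set \<Rightarrow> bool) \<Rightarrow> nat \<Rightarrow> bool" where
  "margin_ok f i \<longleftrightarrow> side i * (\<Sum>j\<in>V - {i}. hyper_matrix (edges f) i j * side j) \<le> - (\<delta> / 2 * D)"

text \<open>
  The majority at \<open>i\<close> is a sum of independent terms of absolute value at most 1, whose mean is at most \<open>- \<delta> D\<close>;
  half of this survives by the Chernoff bound with \<open>s = \<delta> / 4\<close>, the optimal choice for a deviation
  of \<open>\<delta> D / 2\<close>.
\<close>

lemma prob_not_margin_ok:
  assumes i: "i \<in> V"
  shows "measure_pmf.prob P {f. \<not> margin_ok f i} \<le> exp (- (\<delta>\<^sup>2 * D / 16))"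
proof -
  let ?m = "\<Sum>e\<in>Pow V. q e * balance i e"
  have "?m = side i * (\<Sum>j\<in>V - {i}. mean i j * side j)"
    unfolding mean_def by (rule weighted_neighbour_sum[OF i, symmetric])
  hence m: "?m \<le> - (\<delta> * D)" using mean_margin[OF i] by simp
  have "measure_pmf.prob P {f. \<not> margin_ok f i}
    \<le> measure_pmf.prob P {f. (\<Sum>e\<in>Pow V. of_bool (f e) * balance i e) \<ge> ?m + \<delta> / 2 * D}"
  proof (intro measure_pmf.finite_measure_mono subsetI)
    fix f assume "f \<in> {f. \<not> margin_ok f i}"
    hence "side i * (\<Sum>j\<in>V - {i}. hyper_matrix (edges f) i j * side j) > - (\<delta> / 2 * D)"
      by (simp only: margin_ok_def not_le mem_Collect_eq)
    hence "(\<Sum>e\<in>Pow V. of_bool (f e) * balance i e) > - (\<delta> / 2 * D)"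
      unfolding hyper_matrix_edges by (simp only: weighted_neighbour_sum[OF i])
    thus "f \<in> {f. (\<Sum>e\<in>Pow V. of_bool (f e) * balance i e) \<ge> ?m + \<delta> / 2 * D}"
      using m by simp
  qed simp
  also have "\<dots> \<le> exp ((\<delta> / 4)\<^sup>2 * D - \<delta> / 4 * (\<delta> / 2 * D))"
  proof (rule chernoff)
    have "(\<Sum>e | e \<in> Pow V \<and> balance i e \<noteq> 0. q e) \<le> (\<Sum>e | e \<in> Pow V \<and> i \<in> e. q e)"
      using q_nonneg by (intro sum_mono2) (auto simp: balance_def)
    thus "(\<Sum>e | e \<in> Pow V \<and> balance i e \<noteq> 0. q e) \<le> D" using degree_le[OF i] by linarith
  qed (use \<delta> abs_balance_le in auto)
  also have "(\<delta> / 4)\<^sup>2 * D - \<delta> / 4 * (\<delta> / 2 * D) = - (\<delta>\<^sup>2 * D / 16)"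
    by (simp add: power2_eq_square)
  finally show ?thesis .
qed

lemma COLOR_succeeds_if_typical:
  assumes D: "0 < D" and bounded: "fluct_bounded (\<delta>\<^sup>2 / 32 * D) f"
    and margin: "\<And>i. i \<in> V \<Longrightarrow> margin_ok f i"
    and bipartite: "\<And>e. e \<in> edges f \<Longrightarrow> \<not> monochromatic U1 U2 e"
  shows "COLOR_succeeds n (edges f)"
proof -
  interpret near_planted V U1 U2 n "hyper_matrix (edges f)" mean mean_same mean_cross mean_diag D \<delta> "\<delta>\<^sup>2 / 32"
  proof
    show "dotp V (mat_vec V (\<lambda>i j. hyper_matrix (edges f) i j - mean i j) x)
              (mat_vec V (\<lambda>i j. hyper_matrix (edges f) i j - mean i j) x)
            \<le> (\<delta>\<^sup>2 / 32 * D)\<^sup>2 * dotp V x x" for x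
      using bounded by (simp only: hyper_matrix_minus_mean fluct_bounded_def)
    show "side i * (\<Sum>j\<in>V - {i}. hyper_matrix (edges f) i j * side j) \<le> - (\<delta> / 2 * D)"
      if "i \<in> V" for i
      using margin[OF that] by (simp only: margin_ok_def)
  qed (fact U n2 mean_block mean_same_nonneg mean_cross_le D \<delta> mean_gap | use n2 in simp)+
  define T where "T = nat \<lceil>log 2 (real n)\<rceil>"
  have T: "real n \<le> 2 ^ T"
  proof -
    have "real n = 2 powr log 2 (real n)" using n2 by simp
    also have "\<dots> \<le> 2 powr real T" unfolding T_def by (intro powr_mono real_nat_ceiling_ge) simp
    finally show ?thesis by (simp add: powr_realpow)
  qed
  show ?thesis
    unfolding COLOR_succeeds_def
  proof (intro allI impI)
    fix x assume x: "min_unit_vector V (hyper_matrix (edges f)) x"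
    define W where "W = (color_step V (hyper_matrix (edges f)) ^^ T) (color_init V x)"
    have W: "W \<in> {U1, U2}" unfolding W_def by (rule finds_planted_classes[OF x T])
    hence W': "(W = U1 \<and> V - W = U2) \<or> (W = U2 \<and> V - W = U1)" using U by auto
    hence proper: "\<not> e \<subseteq> W \<and> \<not> e \<subseteq> V - W" if "e \<in> edges f" for e
      using bipartite[OF that] by (auto simp: monochromatic_def)
    have "COLOR n (edges f) x = Some (W, V - W)"
      unfolding COLOR_def Let_def T_def[symmetric] W_def[symmetric] using proper by auto
    moreover have "proper_2_coloring V (edges f) W (V - W)"
      using W proper U(1) by (auto simp: proper_2_coloring_def)
    ultimately show "\<exists>W1 W2. COLOR n (edges f) x = Some (W1, W2) \<and> proper_2_coloring V (edges f) W1 W2"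
      by blast
  qed
qed

text \<open>
  This is where the planted partition is seen to be a proper coloring.
\<close>

lemma not_monochromatic_edge:
  assumes "f \<in> set_pmf P" "e \<in> edges f"
  shows "\<not> monochromatic U1 U2 e"
proof
  assume "monochromatic U1 U2 e"
  hence "q e = 0" by (simp add: edge_prob_def)
  moreover have "f \<in> PiE_dflt (Pow V) False (set_pmf \<circ> (\<lambda>e. bernoulli_pmf (q e)))"
    using assms(1) set_Pi_pmf_subset'[OF finite_I, of False "\<lambda>e. bernoulli_pmf (q e)"] by blast
  hence "f e \<in> set_pmf (bernoulli_pmf (q e))"
    using assms(2) unfolding PiE_dflt_def comp_def by blast
  moreover have "f e" using assms by simp
  ultimately show False by (auto simp: set_pmf_iff)
qed

text \<open>
  Each of the two exceptional events has probability at most \<open>2 n * exp (- 2 * ln n) = 2 / n\<close>.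
\<close>

lemma prob_COLOR_succeeds:
  assumes D: "144 * ln n \<le> (\<delta>\<^sup>2 / 32)\<^sup>2 * D" and ln: "1 \<le> ln n"
  shows "measure_pmf.prob (random_hypergraph n U1 U2 M p) {E. COLOR_succeeds n E} \<ge> 1 - 4 / n"
proof -
  define \<epsilon> where "\<epsilon> = \<delta>\<^sup>2 / 32"
  have \<epsilon>: "0 < \<epsilon>" "\<epsilon> \<le> \<delta>" "\<epsilon> \<le> 1"
  proof -
    show "0 < \<epsilon>" using \<delta> by (simp add: \<epsilon>_def)
    have "\<delta>\<^sup>2 \<le> \<delta>" using \<delta> by (simp add: power2_eq_square mult_left_le)
    thus "\<epsilon> \<le> \<delta>" "\<epsilon> \<le> 1" using \<delta> by (simp_all add: \<epsilon>_def)
  qed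
  have D': "144 * ln n \<le> \<epsilon>\<^sup>2 * D" using D by (simp add: \<epsilon>_def)
  have D0: "0 < D"
  proof -
    have "0 < \<epsilon>\<^sup>2 * D" using D' ln by linarith
    thus ?thesis using \<epsilon> by (simp add: zero_less_mult_iff)
  qed
  have exp_n: "exp (- 2 * ln n) = 1 / n\<^sup>2"
    using n2 by (simp add: exp_minus exp_double flip: inverse_eq_divide)
  obtain l where l: "ln n \<le> 2 ^ l" "2 ^ l \<le> 2 * ln n"
  proof -
    define l where "l = (LEAST l. ln (real n) \<le> 2 ^ l)"
    have ex: "\<exists>l. ln (real n) \<le> 2 ^ l" using real_arch_pow[of 2 "ln (real n)"] by (auto intro: less_imp_le)
    have "ln (real n) \<le> 2 ^ l" unfolding l_def by (rule LeastI_ex[OF ex])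
    moreover have "2 ^ l \<le> 2 * ln (real n)"
    proof (cases l)
      case (Suc l')
      hence "\<not> ln (real n) \<le> 2 ^ l'" using not_less_Least[of l' "\<lambda>l. ln (real n) \<le> 2 ^ l"] by (simp add: l_def)
      thus ?thesis using Suc by simp
    qed (use ln in simp)
    ultimately show ?thesis using that by blast
  qed
  define k :: nat where "k = 2 ^ l"
  have k: "ln n \<le> k" "k \<le> 2 * ln n" using l by (simp_all add: k_def)
  have "measure_pmf.prob P {f. \<not> fluct_bounded (\<epsilon> * D) f} \<le> real (card V) * (1 / 9) ^ k"
    using k D' by (intro prob_not_fluct_bounded[where l = l] \<epsilon>) (auto simp: k_def)
  also have "\<dots> \<le> real (card V) * exp (- 2) ^ k"
  proof (intro mult_left_mono power_mono)
    have "exp (2::real) = exp 1 * exp 1" by (simp flip: exp_add)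
    also have "\<dots> \<le> 3 * 3" using exp_le by (intro mult_mono) auto
    finally show "1 / 9 \<le> exp (- 2 :: real)" by (simp add: exp_minus field_simps)
  qed auto
  also have "exp (- 2) ^ k = exp (- 2 * real k)" by (simp add: mult.commute flip: exp_of_nat_mult)
  also have "\<dots> \<le> exp (- 2 * ln n)" using k by simp
  finally have bad1: "measure_pmf.prob P {f. \<not> fluct_bounded (\<epsilon> * D) f} \<le> 2 / n"
    unfolding exp_n using n2 by (simp add: power2_eq_square)
  have "measure_pmf.prob P (\<Union>i\<in>V. {f. \<not> margin_ok f i}) \<le> (\<Sum>i\<in>V. measure_pmf.prob P {f. \<not> margin_ok f i})"
    by (intro measure_pmf.finite_measure_subadditive_finite) auto
  also have "\<dots> \<le> (\<Sum>i\<in>V. exp (- 2 * ln n))"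
  proof (intro sum_mono order.trans[OF prob_not_margin_ok])
    have "\<epsilon>\<^sup>2 * D \<le> \<delta>\<^sup>2 * D" using \<epsilon> D0 by (intro mult_right_mono power_mono) auto
    thus "exp (- (\<delta>\<^sup>2 * D / 16)) \<le> exp (- 2 * ln n)" using D' ln by simp
  qed
  finally have bad2: "measure_pmf.prob P (\<Union>i\<in>V. {f. \<not> margin_ok f i}) \<le> 2 / n"
    unfolding exp_n using n2 by (simp add: power2_eq_square)
  let ?bad = "{f. \<not> fluct_bounded (\<epsilon> * D) f} \<union> (\<Union>i\<in>V. {f. \<not> margin_ok f i})"
  have "measure_pmf.prob P ?bad \<le> 4 / n"
    using measure_Un_le[of "{f. \<not> fluct_bounded (\<epsilon> * D) f}" "measure_pmf P"
        "\<Union>i\<in>V. {f. \<not> margin_ok f i}"] bad1 bad2 by simp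
  moreover have "measure_pmf.prob P (- ?bad) = 1 - measure_pmf.prob P ?bad"
    unfolding Compl_eq_Diff_UNIV
    by (rule measure_pmf.prob_compl[of ?bad P, unfolded space_measure_pmf sets_measure_pmf, OF UNIV_I])
  ultimately have "1 - 4 / n \<le> measure_pmf.prob P (- ?bad)" by linarith
  also have "\<dots> = measure_pmf.prob P (- ?bad \<inter> set_pmf P)" by (rule measure_Int_set_pmf[symmetric])
  also have "\<dots> \<le> measure_pmf.prob P {f. COLOR_succeeds n (edges f)}"
  proof (intro measure_pmf.finite_measure_mono subsetI)
    fix f assume f: "f \<in> - ?bad \<inter> set_pmf P"
    have "COLOR_succeeds n (edges f)"
      using f not_monochromatic_edge[of f] by (intro COLOR_succeeds_if_typical D0) (auto simp: \<epsilon>_def)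
    thus "f \<in> {f. COLOR_succeeds n (edges f)}" by simp
  qed simp
  also have "\<dots> = measure_pmf.prob (random_hypergraph n U1 U2 M p) {E. COLOR_succeeds n E}"
    by (simp add: random_hypergraph_def vimage_def)
  finally show ?thesis .
qed

text \<open>
  Counting incidences, \<open>m * (2n choose m) = 2n * (2n - 1 choose m - 1)\<close>, and \<open>m \<ge> 2\<close>.
\<close>

lemma average_degree_le: "(\<Sum>m=2..M. p m * real ((2 * n) choose m)) \<le> n * D"
  unfolding D_def sum_distrib_left
proof (rule sum_mono)
  fix m assume m: "m \<in> {2..M}"
  have "real m * real ((2 * n) choose m) = 2 * n * real ((2 * n - 1) choose (m - 1))"
    using times_binomial_minus1_eq[of m "2 * n"] m by (simp flip: of_nat_mult)
  moreover have "2 * real ((2 * n) choose m) \<le> real m * real ((2 * n) choose m)"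
    using m by (intro mult_right_mono) auto
  ultimately have "real ((2 * n) choose m) \<le> n * real ((2 * n - 1) choose (m - 1))" by simp
  hence "p m * real ((2 * n) choose m) \<le> p m * (n * real ((2 * n - 1) choose (m - 1)))"
    using p01[OF m] by (intro mult_left_mono) auto
  thus "p m * real ((2 * n) choose m) \<le> n * (p m * real ((2 * n - 1) choose (m - 1)))"
    by (simp add: mult_ac)
qed

end

theorem theorem1:
  fixes K :: nat
  shows "\<exists>d::real. d > 0 \<and>
    (\<forall>(M :: nat \<Rightarrow> nat) (p :: nat \<Rightarrow> nat \<Rightarrow> real) (U1 :: nat \<Rightarrow> nat set) (U2 :: nat \<Rightarrow> nat set).
       (\<forall>n. 2 \<le> M n \<and> M n \<le> K) \<longrightarrow>
       (\<forall>n. \<forall>m\<in>{2..M n}. 0 \<le> p n m \<and> p n m \<le> 1) \<longrightarrow>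
       (\<forall>n. planted_split n (U1 n) (U2 n)) \<longrightarrow>
       (\<forall>\<^sub>F n in sequentially.
          (\<Sum>m=2..M n. p n m * real ((2 * n) choose m)) \<ge> d * real n * ln (real n)) \<longrightarrow>
       (\<lambda>n. measure_pmf.prob (random_hypergraph n (U1 n) (U2 n) (M n) (p n))
              {E. COLOR_succeeds n E}) \<longlonglongrightarrow> 1)"
proof -
  \<comment> \<open>\<open>\<gamma>\<close> is the relative gap \<open>\<delta>\<close> of the planted model, which depends on \<open>K\<close> only. The constant
      144 is \<open>2 * 72\<close>, with the 2 coming from rounding \<open>ln n\<close> up to a power of two.\<close>
  define \<gamma> :: real where "\<gamma> = 1 / real ((2 * K) ^ K)"
  define d where "d = 144 / (\<gamma>\<^sup>2 / 32)\<^sup>2"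
  have \<gamma>_pos: "0 < \<gamma>" by (cases "K = 0") (simp_all add: \<gamma>_def)
  show ?thesis
  proof (intro exI[of _ d] conjI allI impI)
    show "0 < d" using \<gamma>_pos by (simp add: d_def)
    fix M :: "nat \<Rightarrow> nat" and p :: "nat \<Rightarrow> nat \<Rightarrow> real" and U1 U2 :: "nat \<Rightarrow> nat set"
    assume M: "\<forall>n. 2 \<le> M n \<and> M n \<le> K"
      and p: "\<forall>n. \<forall>m\<in>{2..M n}. 0 \<le> p n m \<and> p n m \<le> 1"
      and split: "\<forall>n. planted_split n (U1 n) (U2 n)"
      and dense: "\<forall>\<^sub>F n in sequentially.
          (\<Sum>m=2..M n. p n m * real ((2 * n) choose m)) \<ge> d * real n * ln (real n)"
    let ?pr = "\<lambda>n. measure_pmf.prob (random_hypergraph n (U1 n) (U2 n) (M n) (p n)) {E. COLOR_succeeds n E}"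
    have "\<forall>\<^sub>F n in sequentially. 1 - 4 / real n \<le> ?pr n"
      \<comment> \<open>The lower bound 3 ensures \<open>ln n \<ge> 1\<close>.\<close>
      using dense eventually_ge_at_top[of "max K 3"]
    proof eventually_elim
      case (elim n)
      interpret planted_hypergraph n "M n" K "p n" "U1 n" "U2 n"
        using M p split elim by unfold_locales auto
      have "d * n * ln n \<le> n * D" using elim(1) average_degree_le by linarith
      hence "n * (d * ln n) \<le> n * D" by (simp only: mult_ac)
      hence "d * ln n \<le> D" using n2 by simp
      hence "144 * ln n \<le> (\<gamma>\<^sup>2 / 32)\<^sup>2 * D" using \<gamma>_pos by (simp add: d_def field_simps)
      moreover have "1 \<le> ln (real n)"
      proof -
        have "exp 1 \<le> real n" using exp_le elim by linarith
        thus ?thesis using elim by (simp add: ln_ge_iff)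
      qed
      ultimately show ?case
        by (intro prob_COLOR_succeeds) (simp_all only: \<delta>_def \<gamma>_def)
    qed
    moreover have "\<forall>\<^sub>F n in sequentially. ?pr n \<le> 1" by simp
    moreover have "(\<lambda>n. 1 - 4 / real n) \<longlonglongrightarrow> 1"
      using tendsto_diff[OF tendsto_const lim_const_over_n, of 1 4] by simp
    ultimately show "?pr \<longlonglongrightarrow> 1"
      by (rule tendsto_sandwich[OF _ _ _ tendsto_const])
  qed
qed

end
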